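(* Let $d\ge 1$ be an integer. There is a constant $K=K(d)\ge 0$ such that the following holds. Let $\mathcal H$ be a nonempty finite family of hyperplanes in $\mathbb R^d$ in general position. Then there exists a point $c\in\mathbb R^d$ such that the number of those $(d+1)$-tuples of hyperplanes in $\mathcal H$ that surround $c$ is at least $$ \left(\frac{2d}{(d+1)!\,(d+1)}-\frac{K}{|\mathcal H|}\right)\binom{|\mathcal H|}{d+1}. $$
   Context: Hyperplanes are affine. A $(d+1)$-tuple of hyperplanes in $\mathcal H$ means a subset of $\mathcal H$ consisting of $d+1$ distinct hyperplanes; there are $\binom{|\mathcal H|}{d+1}$ of them. A family of $d+1$ hyperplanes surrounds a point $c$ if $c$ cannot be moved to $\infty$ without touching any of these hyperplanes; that is, $c$ either lies on one of the hyperplanes or lies in a bounded connected component of the complement of their union. General position has its usual meaning: for every $1\le k\le d$, any $k$ distinct hyperplanes of $\mathcal H$ intersect in an affine subspace of dimension exactly $d-k$, and no $d+1$ distinct hyperplanes of $\mathcal H$ have a common point. *)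

theory Defs
  imports "HOL-Analysis.Analysis"
begin

definition hyperplane :: "(real ^ 'n) set \<Rightarrow> bool" where
  "hyperplane h \<longleftrightarrow> (\<exists>a b. a \<noteq> 0 \<and> h = {x. a \<bullet> x = b})"

text \<open>Dimensions are compared in the integers. Since \<open>aff_dim {} = - 1\<close>, the first clause
  in particular makes the intersection of at most \<open>d\<close> members nonempty.\<close>

definition general_position :: "(real ^ 'n) set set \<Rightarrow> bool" where
  "general_position H \<longleftrightarrow>
     (\<forall>S. S \<subseteq> H \<and> finite S \<and> 1 \<le> card S \<and> card S \<le> CARD('n) \<longrightarrow>
        affine (\<Inter>S) \<and> aff_dim (\<Inter>S) = int CARD('n) - int (card S)) \<and>
     (\<forall>S. S \<subseteq> H \<and> finite S \<and> card S = CARD('n) + 1 \<longrightarrow> \<Inter>S = {})"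

definition surrounds :: "(real ^ 'n) set set \<Rightarrow> real ^ 'n \<Rightarrow> bool" where
  "surrounds S c \<longleftrightarrow>
     c \<in> \<Union>S \<or> (\<exists>C \<in> components (- \<Union>S). c \<in> C \<and> bounded C)"

end

theory Submission
  imports Defs "HOL-Library.Z2"
begin

text \<open>
  For a point \<open>c\<close> on no hyperplane, the \<open>(d+1)\<close>-subsets of \<open>H\<close> whose simplex contains \<open>c\<close>
  form a cocycle modulo 2 on the full simplex with vertex set \<open>H\<close>, and moving \<open>c\<close> changes it only
  on sets that contain a hyperplane separating the two positions. This is the setting of Gromov's
  method. Suppose that all these cocycles are small. Take the vertices of a Kuhn triangulation of
  space that is so fine that at most \<open>d\<close> hyperplanes separate the vertices of any simplex. By
  coning off a well-chosen hyperplane, one assigns inductively to every \<open>k\<close>-simplex a small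
  \<open>(d-k-1)\<close>-cochain that cobounds the sum over its facets, where one disregards the hyperplanes
  that separate its vertices. A 1-cocycle is a cut, and choosing its smaller side is what gives the
  factor \<open>2d/(d+1)\<close>. On a \<open>d\<close>-simplex one is left with a 0-cocycle that is too small to be the
  constant 1, so the whole family of cocycles is contracted.

  A contraction cannot exist: restricted to \<open>d+1\<close> hyperplanes, it is homotopic to a
  contraction of the cochains pulled back from a labelling in the style of Sperner of the grid, and
  summing over all \<open>d\<close>-simplices shows that the number of fully labelled ones is even, whereas
  exactly one simplex is fully labelled.
\<close>

section \<open>Cochains modulo 2\<close>

text \<open>The cocycles of two grid points agree only on sets that avoid the hyperplanes separating
  them, which is why separators are discarded. At most d of them occur per simplex, so every filling
  still has at least \<open>card H - d\<close> hyperplanes at its disposal, and the loss fits into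
  the term K/|H|. Relative to the number of available sets, filling from the best apex costs
  asymptotically nothing, while adding up facets in all dimensions below d multiplies sizes by d!.
  On a d-simplex, d+1 sets of hyperplanes must not add up to everything, so each may have only a
  share below 1/(d+1). A cut at that share contains a fraction 2d/(d+1)^2 of all pairs; dividing by
  d! yields the constant. The parity count needs one hyperplane that serves for every simplex,
  whereas the contraction is controlled only away from separators. Among d+1 hyperplanes at least
  one does not separate a given simplex, and coning from it repairs the contraction. This is why the
  comparison takes place on exactly d+1 of them.\<close>

declare add_bit_eq_xor [simp del]

lemma bit_add_self [simp]: "a + a = 0" for a :: bit
  by (cases a) auto

lemma bit_eq_iff_add: "a = b \<longleftrightarrow> a + b = 0" for a b :: bit
  by (cases a; cases b) auto

lemma sum_symmetric_pairs_eq_0: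
  fixes g :: "'a \<Rightarrow> 'a \<Rightarrow> bit"
  assumes "finite S" and sym: "\<And>s t. s \<in> S \<Longrightarrow> t \<in> S \<Longrightarrow> s \<noteq> t \<Longrightarrow> g s t = g t s"
  shows "(\<Sum>s\<in>S. \<Sum>t\<in>S - {s}. g s t) = 0"
proof -
  have "(\<Sum>s\<in>S. \<Sum>t\<in>S - {s}. g s t) = (\<Sum>(s, t)\<in>(SIGMA s:S. S - {s}). g s t)"
    using assms(1) by (subst sum.Sigma) auto
  also have "\<dots> = 0"
    by (rule sum_involution_eq_0[where h = prod.swap]) (auto, metis bit_add_self sym zero_neq_one)
  finally show ?thesis .
qed

text \<open>A cochain is a function on all sets, and only its values at the relevant cardinality
  matter. The same operator is applied to sets of hyperplanes and, with the hyperplanes fixed, to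
  the faces of a grid simplex.\<close>

definition cobd :: "('a set \<Rightarrow> bit) \<Rightarrow> 'a set \<Rightarrow> bit" where
  "cobd f S = (\<Sum>s\<in>S. f (S - {s}))"

lemma cobd_cobd: "finite S \<Longrightarrow> cobd (cobd f) S = 0"
  unfolding cobd_def by (rule sum_symmetric_pairs_eq_0) (auto simp: insert_commute Diff_insert2[symmetric])

lemma cobd_add: "cobd (\<lambda>T. f T + g T) S = cobd f S + cobd g S"
  unfolding cobd_def by (rule sum.distrib)

lemma cobd_pair: "h \<noteq> k \<Longrightarrow> cobd f {h, k} = f {h} + f {k}"
  by (simp add: cobd_def insert_Diff_if add.commute)

lemma cobd_cong: "(\<And>s. s \<in> S \<Longrightarrow> f (S - {s}) = g (S - {s})) \<Longrightarrow> cobd f S = cobd g S"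
  by (simp add: cobd_def)

lemma cobd_0 [simp]: "cobd (\<lambda>T. 0) S = 0"
  by (simp add: cobd_def)

lemma cobd_swap: "cobd (\<lambda>\<tau>. cobd (G \<tau>) S) \<sigma> = cobd (\<lambda>T. cobd (\<lambda>\<tau>. G \<tau> T) \<sigma>) S"
  unfolding cobd_def by (rule sum.swap)

text \<open>The contracting homotopy of the full simplex towards the vertex \<open>x\<close>,
  written for cochains.\<close>

definition cone_off :: "'a \<Rightarrow> ('a set \<Rightarrow> bit) \<Rightarrow> 'a set \<Rightarrow> bit" where
  "cone_off x E T = (if x \<in> T then 0 else E (insert x T))"

text \<open>For \<open>x \<in> S\<close> only the removal of \<open>x\<close> contributes. Otherwise
  the coboundary of \<open>E\<close> at \<open>insert x S\<close> consists of \<open>E S\<close> and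
  exactly the terms of \<open>cobd (cone_off x E) S\<close>.\<close>

lemma cobd_cone_off:
  assumes S: "finite S" and cocycle: "x \<notin> S \<Longrightarrow> cobd E (insert x S) = 0"
  shows "cobd (cone_off x E) S = E S"
proof (cases "x \<in> S")
  case True
  have "cobd (cone_off x E) S = (\<Sum>s\<in>S. if s = x then E S else 0)"
    unfolding cobd_def cone_off_def using True by (intro sum.cong) (auto simp: insert_absorb)
  then show ?thesis
    using S True by simp
next
  case False
  have "cobd (cone_off x E) S = (\<Sum>s\<in>S. E (insert x S - {s}))"
    unfolding cobd_def cone_off_def using False by (intro sum.cong) (auto simp: insert_Diff_if)
  moreover have "cobd E (insert x S) = E S + (\<Sum>s\<in>S. E (insert x S - {s}))"
    unfolding cobd_def using S False by simp
  ultimately show ?thesis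
    using cocycle[OF False] by (metis add.commute bit_eq_iff_add)
qed

section \<open>Supports of cochains and small fillings\<close>

definition supp :: "'a set \<Rightarrow> nat \<Rightarrow> ('a set \<Rightarrow> bit) \<Rightarrow> 'a set set" where
  "supp X j f = {S. S \<subseteq> X \<and> card S = j \<and> f S = 1}"

lemma finite_supp [simp]: "finite X \<Longrightarrow> finite (supp X j f)"
  unfolding supp_def by (rule finite_subset[of _ "Pow X"]) auto

lemma supp_mono: "X \<subseteq> Y \<Longrightarrow> supp X j f \<subseteq> supp Y j f"
  by (auto simp: supp_def)

lemma supp_0 [simp]: "supp X j (\<lambda>T. 0) = {}"
  by (simp add: supp_def)

lemma card_supp_sum:
  assumes "finite I" "finite X"
  shows "card (supp X j (\<lambda>S. \<Sum>i\<in>I. g i S)) \<le> (\<Sum>i\<in>I. card (supp X j (g i)))"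
proof -
  have "supp X j (\<lambda>S. \<Sum>i\<in>I. g i S) \<subseteq> (\<Union>i\<in>I. supp X j (g i))"
  proof
    fix S assume S: "S \<in> supp X j (\<lambda>S. \<Sum>i\<in>I. g i S)"
    then have "\<exists>i\<in>I. g i S \<noteq> 0"
      unfolding supp_def by (metis (mono_tags, lifting) mem_Collect_eq sum.neutral zero_neq_one)
    with S show "S \<in> (\<Union>i\<in>I. supp X j (g i))"
      by (auto simp: supp_def)
  qed
  then have "card (supp X j (\<lambda>S. \<Sum>i\<in>I. g i S)) \<le> card (\<Union>i\<in>I. supp X j (g i))"
    using assms by (intro card_mono) auto
  also have "\<dots> \<le> (\<Sum>i\<in>I. card (supp X j (g i)))"
    using assms by (intro card_UN_le)
  finally show ?thesis .
qed

text \<open>Averaging over the apex: a set \<open>S\<close> in the support of \<open>E\<close>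
  reappears in the cone with apex \<open>y\<close> only for \<open>y \<in> S\<close>, as
  \<open>S - {y}\<close>. So the cones over all apexes together have at most \<open>Suc j\<close>
  times as many sets as \<open>E\<close>, and the best apex does no worse than the average.\<close>

lemma small_filling:
  assumes X: "finite X" "X \<noteq> {}"
    and cocycle: "\<And>U. U \<subseteq> X \<Longrightarrow> card U = Suc (Suc j) \<Longrightarrow> cobd E U = 0"
  obtains G where "\<And>S. S \<subseteq> X \<Longrightarrow> card S = Suc j \<Longrightarrow> cobd G S = E S"
    and "card X * card (supp X j G) \<le> Suc j * card (supp X (Suc j) E)"
proof -
  define L where "L x = supp X j (cone_off x E)" for x
  have "Min ((\<lambda>x. card (L x)) ` X) \<in> (\<lambda>x. card (L x)) ` X"
    using X by (intro Min_in) auto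
  then obtain x where x: "x \<in> X" "Min ((\<lambda>x. card (L x)) ` X) = card (L x)"
    by auto
  have "card X * card (L x) \<le> (\<Sum>y\<in>X. card (L y))"
  proof -
    have "card (L x) \<le> card (L y)" if "y \<in> X" for y
      using x(2) X that by (metis Min_le finite_imageI imageI)
    then show ?thesis
      using sum_bounded_below[of X "card (L x)" "\<lambda>y. card (L y)"] by simp
  qed
  also have "\<dots> = card (SIGMA y:X. L y)"
    using X by (subst card_SigmaI) (auto simp: L_def)
  also have "\<dots> \<le> card (SIGMA S:supp X (Suc j) E. S)"
  proof (rule card_inj_on_le)
    show "inj_on (\<lambda>(y, T). (insert y T, y)) (SIGMA y:X. L y)"
      by (auto simp: inj_on_def L_def supp_def cone_off_def split: if_splits)
         (metis insert_ident)+
    show "(\<lambda>(y, T). (insert y T, y)) ` (SIGMA y:X. L y) \<subseteq> (SIGMA S:supp X (Suc j) E. S)"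
      using X by (auto simp: L_def supp_def cone_off_def card_insert_if finite_subset split: if_splits)
    show "finite (SIGMA S:supp X (Suc j) E. S)"
      using X by (intro finite_SigmaI) (auto simp: supp_def intro: finite_subset)
  qed
  also have "\<dots> = (\<Sum>S\<in>supp X (Suc j) E. card S)"
    using X by (subst card_SigmaI) (auto simp: supp_def intro: finite_subset)
  also have "\<dots> = (\<Sum>S\<in>supp X (Suc j) E. Suc j)"
    by (rule sum.cong) (auto simp: supp_def)
  also have "\<dots> = Suc j * card (supp X (Suc j) E)"
    by (simp add: algebra_simps)
  finally have small: "card X * card (supp X j (cone_off x E)) \<le> Suc j * card (supp X (Suc j) E)"
    by (simp add: L_def)
  have "cobd (cone_off x E) S = E S" if "S \<subseteq> X" "card S = Suc j" for S
  proof (rule cobd_cone_off)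
    show "finite S"
      using X that finite_subset by blast
    then show "x \<notin> S \<Longrightarrow> cobd E (insert x S) = 0"
      using that x(1) by (intro cocycle) auto
  qed
  with small show ?thesis
    by (rule that[rotated])
qed

lemma supp_1: "supp X (Suc 0) G = (\<lambda>h. {h}) ` {h \<in> X. G {h} = 1}"
  by (auto simp: supp_def card_Suc_eq)

text \<open>A cochain on singletons is a set of hyperplanes, and its coboundary consists of the
  pairs across the cut between this set and its complement. Counting these pairs gives a quadratic
  bound, sharper than the linear one of \<open>small_filling\<close>.\<close>

lemma cut_filling:
  assumes X: "finite X" "X \<noteq> {}"
    and cocycle: "\<And>U. U \<subseteq> X \<Longrightarrow> card U = 3 \<Longrightarrow> cobd E U = 0"
  obtains G where "\<And>S. S \<subseteq> X \<Longrightarrow> card S = 2 \<Longrightarrow> cobd G S = E S"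
    and "2 * card (supp X 1 G) \<le> card X"
    and "card (supp X 1 G) * (card X - card (supp X 1 G)) \<le> card (supp X 2 E)"
proof -
  obtain G where G: "\<And>S. S \<subseteq> X \<Longrightarrow> card S = 2 \<Longrightarrow> cobd G S = E S"
  proof (rule small_filling[OF X, of 1 E])
    show "cobd E U = 0" if "U \<subseteq> X" "card U = Suc (Suc 1)" for U
      using that by (intro cocycle) auto
  next
    fix G assume "\<And>S. S \<subseteq> X \<Longrightarrow> card S = Suc 1 \<Longrightarrow> cobd G S = E S"
    then show thesis
      by (intro that[of G]) auto
  qed
  have card_cut: "card (supp X 1 G) * (card X - card (supp X 1 G)) \<le> card (supp X 2 E)"
    if G: "\<And>S. S \<subseteq> X \<Longrightarrow> card S = 2 \<Longrightarrow> cobd G S = E S" for G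
  proof -
    define A where "A = {h \<in> X. G {h} = 1}"
    have A: "A \<subseteq> X" "finite A" "card (supp X 1 G) = card A"
      using X by (auto simp: A_def supp_1 card_image)
    have "card A * (card X - card A) = card (A \<times> (X - A))"
      using A by (simp add: card_cartesian_product card_Diff_subset)
    also have "\<dots> \<le> card (supp X 2 E)"
    proof (rule card_inj_on_le)
      show "inj_on (\<lambda>(h, k). {h, k}) (A \<times> (X - A))"
        by (auto simp: inj_on_def doubleton_eq_iff)
      show "(\<lambda>(h, k). {h, k}) ` (A \<times> (X - A)) \<subseteq> supp X 2 E"
      proof clarify
        fix h k assume hk: "h \<in> A" "k \<in> X" "k \<notin> A"
        then have "h \<noteq> k" "h \<in> X" "G {h} = 1" "G {k} = 0"
          by (auto simp: A_def)
        then show "{h, k} \<in> supp X 2 E"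
          using hk G[of "{h, k}"] by (auto simp: supp_def cobd_pair)
      qed
    qed (use X in auto)
    finally show ?thesis
      using A by simp
  qed
  \<comment> \<open>The other side of the same cut: on pairs the constant 1 has coboundary
    0.\<close>
  define G' where "G' T = G T + 1" for T
  have G': "cobd G' S = E S" if S: "S \<subseteq> X" "card S = 2" for S
  proof -
    obtain h k where S2: "S = {h, k}" "h \<noteq> k"
      using S by (auto simp: card_2_iff)
    have "cobd G' S = G' {h} + G' {k}" "cobd G S = G {h} + G {k}"
      using S2 by (simp_all add: cobd_pair)
    then show ?thesis
      using G[OF S] by (cases "G {h}"; cases "G {k}") (auto simp: G'_def)
  qed
  have "{h \<in> X. G {h} = 1} \<union> {h \<in> X. G' {h} = 1} = X"
    "{h \<in> X. G {h} = 1} \<inter> {h \<in> X. G' {h} = 1} = {}"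
    by (auto simp: G'_def)
  then have "card X = card (supp X 1 G) + card (supp X 1 G')"
    using X card_Un_disjoint[of "{h \<in> X. G {h} = 1}" "{h \<in> X. G' {h} = 1}"]
    by (simp add: supp_1 card_image)
  then have "2 * card (supp X 1 G) \<le> card X \<or> 2 * card (supp X 1 G') \<le> card X"
    by linarith
  then show ?thesis
  proof
    assume "2 * card (supp X 1 G) \<le> card X"
    then show ?thesis
      by (intro that[of G] G card_cut)
  next
    assume "2 * card (supp X 1 G') \<le> card X"
    then show ?thesis
      by (intro that[of G'] G' card_cut)
  qed
qed

text \<open>The pairs force all values on singletons to coincide, so a single nonzero value would
  put every singleton into the support.\<close>

lemma constant_cochain_eq_0:
  assumes X: "finite X" and cocycle: "\<And>U. U \<subseteq> X \<Longrightarrow> card U = 2 \<Longrightarrow> cobd E U = 0"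
    and small: "card (supp X 1 E) < card X" and h: "h \<in> X"
  shows "E {h} = 0"
proof (rule ccontr)
  assume E: "E {h} \<noteq> 0"
  have "E {k} = 1" if k: "k \<in> X" for k
  proof (cases "k = h")
    case False
    with cocycle[of "{h, k}"] h k have "E {h} + E {k} = 0"
      by (subst cobd_pair[symmetric]) auto
    then show ?thesis
      using E by (cases "E {k}") auto
  qed (use E in auto)
  then have "{k \<in> X. E {k} = 1} = X"
    by auto
  then show False
    using small by (simp add: supp_1 card_image)
qed

section \<open>Contracting a family of cocycles\<close>

lemma Diff_singleton_nonempty: "2 \<le> card \<sigma> \<Longrightarrow> \<sigma> - {v} \<noteq> {}"
  using card_mono[of "{v}" \<sigma>] by auto

text \<open>In the application, \<open>K\<close> consists of the faces of the grid simplices,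
  \<open>N \<sigma>\<close> of the hyperplanes that separate two vertices of
  \<open>\<sigma>\<close>, \<open>F v\<close> is the cocycle seen from \<open>v\<close>, and
  \<open>B\<close> is the finite set of grid points enclosed by some simplex of hyperplanes.\<close>

locale separation_complex =
  fixes H :: "'h set" and K :: "'v set set" and N :: "'v set \<Rightarrow> 'h set"
    and B :: "'v set" and d :: nat and F :: "'v \<Rightarrow> 'h set \<Rightarrow> bit"
  assumes finite_H: "finite H" and d_pos: "d \<ge> 1" and d_less: "d < card H"
    and face_finite: "\<sigma> \<in> K \<Longrightarrow> finite \<sigma>"
    and face_subset: "\<sigma> \<in> K \<Longrightarrow> \<tau> \<subseteq> \<sigma> \<Longrightarrow> \<tau> \<in> K"
    and N_mono: "\<tau> \<subseteq> \<sigma> \<Longrightarrow> N \<tau> \<subseteq> N \<sigma>"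
    and N_singleton: "N {v} = {}"
    and finite_N: "\<sigma> \<in> K \<Longrightarrow> finite (N \<sigma>)"
    and card_N: "\<sigma> \<in> K \<Longrightarrow> card (N \<sigma>) \<le> d"
    and F_cocycle: "{v} \<in> K \<Longrightarrow> U \<subseteq> H \<Longrightarrow> card U = d + 2 \<Longrightarrow> cobd (F v) U = 0"
    and F_agree: "{v, w} \<in> K \<Longrightarrow> S \<subseteq> H - N {v, w} \<Longrightarrow> card S = d + 1 \<Longrightarrow> F v S = F w S"
    and F_outside: "v \<notin> B \<Longrightarrow> F v = (\<lambda>S. 0)"
begin

text \<open>In every degree the cochain attached to \<open>\<sigma>\<close> has to cobound this one; the convention for vertices
  lets one induction treat all degrees.\<close>

definition boundary_cochain :: "('v set \<Rightarrow> 'h set \<Rightarrow> bit) \<Rightarrow> 'v set \<Rightarrow> 'h set \<Rightarrow> bit" where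
  "boundary_cochain G \<sigma> = (if card \<sigma> = 1 then F (the_elem \<sigma>) else (\<lambda>S. cobd (\<lambda>\<tau>. G \<tau> S) \<sigma>))"

lemma boundary_cochain_singleton [simp]: "boundary_cochain G {v} = F v"
  by (simp add: boundary_cochain_def)

lemma boundary_cochain_cong:
  assumes "\<And>v. v \<in> \<sigma> \<Longrightarrow> G (\<sigma> - {v}) = G' (\<sigma> - {v})"
  shows "boundary_cochain G \<sigma> = boundary_cochain G' \<sigma>"
  using assms by (simp add: boundary_cochain_def cobd_def)

text \<open>The coboundaries over hyperplanes and over grid vertices commute, so the facets' own
  equations can be inserted; then every face of codimension two occurs twice and cancels. For edges
  \<open>F_agree\<close> takes the place of this cancellation. The equations of the facets apply
  because sets avoiding \<open>N \<sigma>\<close> avoid the smaller \<open>N\<close> of each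
  facet.\<close>

lemma boundary_cochain_cocycle:
  assumes \<sigma>: "\<sigma> \<in> K" "\<sigma> \<noteq> {}" "card \<sigma> \<le> d + 1"
    and facets: "\<And>v S. v \<in> \<sigma> \<Longrightarrow> \<sigma> - {v} \<noteq> {} \<Longrightarrow> S \<subseteq> H - N (\<sigma> - {v}) \<Longrightarrow>
      card S = d + 3 - card \<sigma> \<Longrightarrow> cobd (G (\<sigma> - {v})) S = boundary_cochain G (\<sigma> - {v}) S"
    and U: "U \<subseteq> H - N \<sigma>" "card U = d + 3 - card \<sigma>"
  shows "cobd (boundary_cochain G \<sigma>) U = 0"
proof -
  have fin: "finite \<sigma>"
    using \<sigma>(1) by (rule face_finite)
  have "card \<sigma> > 0"
    using fin \<sigma> by (simp add: card_gt_0_iff)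
  then consider "card \<sigma> = 1" | "card \<sigma> \<ge> 2"
    by linarith
  then show ?thesis
  proof cases
    case 1
    then obtain v where "\<sigma> = {v}"
      by (auto simp: card_1_singleton_iff)
    then show ?thesis
      using F_cocycle[of v U] \<sigma> U by auto
  next
    case 2
    have ne: "\<sigma> - {v} \<noteq> {}" for v
      using 2 by (rule Diff_singleton_nonempty)
    have "cobd (boundary_cochain G \<sigma>) U = cobd (\<lambda>\<tau>. cobd (G \<tau>) U) \<sigma>"
      using 2 by (simp add: boundary_cochain_def cobd_swap[of G])
    also have "\<dots> = cobd (\<lambda>\<tau>. boundary_cochain G \<tau> U) \<sigma>"
    proof (rule cobd_cong)
      fix v assume "v \<in> \<sigma>"
      then show "cobd (G (\<sigma> - {v})) U = boundary_cochain G (\<sigma> - {v}) U"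
        using ne U N_mono[of "\<sigma> - {v}" \<sigma>] by (intro facets) auto
    qed
    also have "\<dots> = 0"
    proof (cases "card \<sigma> = 2")
      case True
      then obtain v w where vw: "\<sigma> = {v, w}" "v \<noteq> w"
        by (auto simp: card_2_iff)
      then have "cobd (\<lambda>\<tau>. boundary_cochain G \<tau> U) \<sigma> = F v U + F w U"
        by (simp add: cobd_pair)
      also have "F v U = F w U"
        using \<sigma> U vw by (intro F_agree) auto
      finally show ?thesis
        by simp
    next
      case False
      have "cobd (\<lambda>\<tau>. boundary_cochain G \<tau> U) \<sigma> = cobd (cobd (\<lambda>\<rho>. G \<rho> U)) \<sigma>"
        using 2 False fin by (intro cobd_cong) (auto simp: boundary_cochain_def)
      also have "\<dots> = 0"
        by (rule cobd_cobd[OF fin])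
      finally show ?thesis .
    qed
    finally show ?thesis .
  qed
qed

text \<open>A simplex with \<open>k\<close> vertices carries a cochain on sets of size
  \<open>d + 1 - k\<close>. For \<open>k = d + 1\<close> this is the value at the empty set;
  requiring it to be 0 says that the facets cancel on singletons outside \<open>N \<sigma>\<close>.
  Vanishing away from \<open>B\<close> will make the sums over the infinite grid finite.\<close>

definition contracts :: "('v set \<Rightarrow> 'h set \<Rightarrow> bit) \<Rightarrow> 'v set \<Rightarrow> ('h set \<Rightarrow> bit) \<Rightarrow> bool" where
  "contracts G \<sigma> g \<longleftrightarrow>
     (\<forall>S\<subseteq>H - N \<sigma>. card S = d + 2 - card \<sigma> \<longrightarrow> cobd g S = boundary_cochain G \<sigma> S) \<and>
     (\<sigma> \<inter> B = {} \<or> card \<sigma> = d + 1 \<longrightarrow> g = (\<lambda>T. 0))"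

text \<open>The hypothesis on \<open>A\<close> is tuned to the last two steps. The
  \<open>d + 1\<close> facets of a \<open>d\<close>-simplex must not add up to the constant 1, so
  each may carry fewer than \<open>m / (d + 1)\<close> hyperplanes, and the bound on the pairs
  across a cut has to guarantee this.\<close>

lemma ex_contraction:
  assumes small: "\<And>v. {v} \<in> K \<Longrightarrow> real (card (supp H (d + 1) (F v))) \<le> A"
    and A: "A * fact d * fact (d + 1) * (real d + 1)\<^sup>2 < 2 * real d * (real (card H) - real d) ^ (d + 1)"
  obtains G where "\<And>\<sigma>. \<sigma> \<in> K \<Longrightarrow> \<sigma> \<noteq> {} \<Longrightarrow> card \<sigma> \<le> d + 1 \<Longrightarrow> contracts G \<sigma> (G \<sigma>)"
proof -
  define m where "m = real (card H) - real d"
  have m: "m > 0"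
    using d_less by (simp add: m_def)
  \<comment> \<open>Adding up \<open>k\<close> facets multiplies the size by \<open>k\<close>, and filling by \<open>(d + 2 - k) / m\<close>.\<close>
  define b where "b k = A * fact k * fact (d + 1) / (fact (d + 1 - k) * m ^ k)" for k
  \<comment> \<open>The size invariant changes form at \<open>card \<sigma> = d\<close>: there the
    linear bound \<open>b\<close> gives way to the strict bound obtained from the cut.\<close>
  define P where "P G \<sigma> g \<longleftrightarrow> (\<sigma> \<in> K \<and> \<sigma> \<noteq> {} \<and> card \<sigma> \<le> d + 1 \<longrightarrow> contracts G \<sigma> g \<and>
      (card \<sigma> < d \<longrightarrow> real (card (supp (H - N \<sigma>) (d + 1 - card \<sigma>) g)) \<le> b (card \<sigma>)) \<and>
      (card \<sigma> = d \<longrightarrow> (real d + 1) * real (card (supp (H - N \<sigma>) 1 g)) < m))"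
    for G :: "'v set \<Rightarrow> 'h set \<Rightarrow> bit" and \<sigma> g
  have "\<exists>G. \<forall>\<sigma>. P G \<sigma> (G \<sigma>)"
  proof (rule dependent_wf_choice[OF wf_finite_psubset])
    fix G G' :: "'v set \<Rightarrow> 'h set \<Rightarrow> bit" and \<sigma> g
    assume *: "\<And>\<tau>. (\<tau>, \<sigma>) \<in> finite_psubset \<Longrightarrow> G \<tau> = G' \<tau>"
    show "P G \<sigma> g = P G' \<sigma> g"
    proof (cases "\<sigma> \<in> K")
      case True
      then have "boundary_cochain G \<sigma> = boundary_cochain G' \<sigma>"
        by (intro boundary_cochain_cong *) (auto simp: face_finite)
      then show ?thesis
        by (simp add: P_def contracts_def)
    qed (simp add: P_def)
  next
    fix \<sigma> and G :: "'v set \<Rightarrow> 'h set \<Rightarrow> bit"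
    assume IH: "\<And>\<tau>. (\<tau>, \<sigma>) \<in> finite_psubset \<Longrightarrow> P G \<tau> (G \<tau>)"
    show "\<exists>g. P G \<sigma> g"
    proof (cases "\<sigma> \<in> K \<and> \<sigma> \<noteq> {} \<and> card \<sigma> \<le> d + 1")
      case True
      define k where "k = card \<sigma>"
      define X where "X = H - N \<sigma>"
      define E where "E = boundary_cochain G \<sigma>"
      have \<sigma>: "\<sigma> \<in> K" "\<sigma> \<noteq> {}" "k \<le> d + 1" "finite \<sigma>"
        using True face_finite by (auto simp: k_def)
      then have k: "k \<ge> 1"
        by (simp add: k_def Suc_leI card_gt_0_iff)
      obtain v0 where "v0 \<in> \<sigma>"
        using \<sigma> by auto
      then have "{v0} \<in> K"
        using face_subset \<sigma> by simp
      then have A0: "A \<ge> 0"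
        using small[of v0] by linarith
      have X: "finite X" "real (card X) \<ge> m"
        using finite_H card_N[of \<sigma>] finite_N[of \<sigma>] \<sigma> diff_card_le_card_Diff[of "N \<sigma>" H]
        by (auto simp: X_def m_def)
      then have X_ne: "X \<noteq> {}"
        using m by auto
      have facet: "P G (\<sigma> - {v}) (G (\<sigma> - {v}))" "\<sigma> - {v} \<in> K" "card (\<sigma> - {v}) = k - 1"
        if "v \<in> \<sigma>" for v
        using IH[of "\<sigma> - {v}"] that \<sigma> face_subset by (auto simp: k_def)
      have facet_ne: "\<sigma> - {v} \<noteq> {}" if "k \<ge> 2" "v \<in> \<sigma>" for v
        using that Diff_singleton_nonempty by (simp add: k_def)
      have facet_contracts: "contracts G (\<sigma> - {v}) (G (\<sigma> - {v}))" if "k \<ge> 2" "v \<in> \<sigma>" for v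
        using facet[OF that(2)] facet_ne[OF that] \<sigma>(3) by (auto simp: P_def)
      have cocycle: "cobd E U = 0" if "U \<subseteq> X" "card U = d + 3 - k" for U
        unfolding E_def
      proof (rule boundary_cochain_cocycle)
        fix v S assume v: "v \<in> \<sigma>" "\<sigma> - {v} \<noteq> {}" and S: "S \<subseteq> H - N (\<sigma> - {v})" "card S = d + 3 - card \<sigma>"
        have "card (\<sigma> - {v}) > 0"
          using v(2) \<sigma>(4) by (simp add: card_gt_0_iff)
        then have "k \<ge> 2"
          using facet(3)[OF v(1)] by linarith
        moreover from this have "card S = d + 2 - card (\<sigma> - {v})"
          using S(2) facet(3)[OF v(1)] by (simp add: k_def)
        ultimately show "cobd (G (\<sigma> - {v})) S = boundary_cochain G (\<sigma> - {v}) S"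
          using facet_contracts[of v] v(1) S(1) unfolding contracts_def by blast
      qed (use \<sigma> that in \<open>auto simp: X_def k_def\<close>)
      have E_supp: "card (supp X j E) \<le> (\<Sum>v\<in>\<sigma>. card (supp (H - N (\<sigma> - {v})) j (G (\<sigma> - {v}))))"
        if "k \<ge> 2" for j
      proof -
        have "supp X j E = supp X j (\<lambda>S. \<Sum>v\<in>\<sigma>. G (\<sigma> - {v}) S)"
          using that by (simp add: E_def boundary_cochain_def cobd_def k_def)
        also have "card \<dots> \<le> (\<Sum>v\<in>\<sigma>. card (supp X j (G (\<sigma> - {v}))))"
          using \<sigma> X by (intro card_supp_sum)
        also have "\<dots> \<le> (\<Sum>v\<in>\<sigma>. card (supp (H - N (\<sigma> - {v})) j (G (\<sigma> - {v}))))"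
        proof (intro sum_mono card_mono supp_mono)
          fix v show "X \<subseteq> H - N (\<sigma> - {v})"
            unfolding X_def using N_mono[of "\<sigma> - {v}" \<sigma>] by auto
        qed (use finite_H in auto)
        finally show ?thesis .
      qed
      have E_small: "real (card (supp X (d + 2 - k) E)) \<le> k * b (k - 1)" if "k \<le> d"
      proof (cases "k = 1")
        case True
        then obtain v where v: "\<sigma> = {v}"
          unfolding k_def by (auto simp: card_1_singleton_iff)
        have "card (supp X (d + 1) (F v)) \<le> card (supp H (d + 1) (F v))"
          unfolding X_def using finite_H by (intro card_mono supp_mono) auto
        then have "real (card (supp X (d + 1) (F v))) \<le> A"
          using small[of v] v \<sigma> by force
        then show ?thesis
          using True by (simp add: E_def v b_def)
      next
        case False
        then have k2: "k \<ge> 2"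
          using k by linarith
        have "real (card (supp X (d + 2 - k) E)) \<le> (\<Sum>v\<in>\<sigma>. real (card (supp (H - N (\<sigma> - {v})) (d + 2 - k) (G (\<sigma> - {v})))))"
          unfolding of_nat_sum[symmetric] of_nat_le_iff by (rule E_supp[OF k2])
        also have "\<dots> \<le> (\<Sum>v\<in>\<sigma>. b (k - 1))"
        proof (rule sum_mono)
          fix v assume v: "v \<in> \<sigma>"
          have "d + 1 - (k - 1) = d + 2 - k" "k - 1 < d" "k - 1 \<le> d + 1"
            using k2 that by auto
          then show "real (card (supp (H - N (\<sigma> - {v})) (d + 2 - k) (G (\<sigma> - {v})))) \<le> b (k - 1)"
            using facet[OF v] facet_ne[OF k2 v] unfolding P_def by auto
        qed
        finally show ?thesis
          by (simp add: k_def)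
      qed
      show ?thesis
      \<comment> \<open>Away from \<open>B\<close> the facets contribute nothing, and the filling
        has to be 0 itself rather than some small cochain.\<close>
      proof (cases "\<sigma> \<inter> B = {}")
        case True
        have "E = (\<lambda>S. 0)"
        proof (cases "k = 1")
          case True
          then obtain v where "\<sigma> = {v}"
            unfolding k_def by (auto simp: card_1_singleton_iff)
          with \<open>\<sigma> \<inter> B = {}\<close> show ?thesis
            by (simp add: E_def F_outside)
        next
          case False
          then have "G (\<sigma> - {v}) = (\<lambda>S. 0)" if "v \<in> \<sigma>" for v
            using facet_contracts[of v] that k True unfolding contracts_def by auto
          then show ?thesis
            using False by (simp add: E_def boundary_cochain_def k_def cobd_def)
        qed
        then have "P G \<sigma> (\<lambda>S. 0)"
          using m A0 by (simp add: P_def contracts_def E_def[symmetric] b_def)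
        then show ?thesis by (rule exI[of _ "\<lambda>S. 0"])
      next
        case False
        consider "k < d" | "k = d" | "k = d + 1"
          using \<sigma> by linarith
        then show ?thesis
        proof cases
          case 1
          have j: "Suc (d + 1 - k) = d + 2 - k" "Suc (d + 2 - k) = d + 3 - k"
            using 1 by auto
          obtain g where g: "\<And>S. S \<subseteq> X \<Longrightarrow> card S = d + 2 - k \<Longrightarrow> cobd g S = E S"
            and "card X * card (supp X (d + 1 - k) g) \<le> (d + 2 - k) * card (supp X (d + 2 - k) E)"
            using small_filling[OF X(1) X_ne, of "d + 1 - k" E] cocycle unfolding j by metis
          then have "real (card X) * real (card (supp X (d + 1 - k) g)) \<le>
              real (d + 2 - k) * real (card (supp X (d + 2 - k) E))"
            by (metis of_nat_le_iff of_nat_mult)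
          moreover have "m * real (card (supp X (d + 1 - k) g)) \<le>
              real (card X) * real (card (supp X (d + 1 - k) g))"
            using X by (intro mult_right_mono) auto
          moreover have "real (d + 2 - k) * real (card (supp X (d + 2 - k) E)) \<le>
              real (d + 2 - k) * (k * b (k - 1))"
            using E_small 1 by (intro mult_left_mono) auto
          ultimately have "m * real (card (supp X (d + 1 - k) g)) \<le> real (d + 2 - k) * (k * b (k - 1))"
            by linarith
          also have "\<dots> = m * b k"
          proof -
            obtain l where l: "k = Suc l"
              using k by (cases k) auto
            have "fact (d + 1 - l) = real (d + 1 - l) * fact (d + 1 - k)"
              using l 1 by (subst fact_reduce) (auto simp: Suc_diff_Suc)
            moreover have "real (d + 1 - l) \<noteq> 0"
              using l 1 by simp
            ultimately show ?thesis
              using m l 1 by (simp add: b_def field_simps del: of_nat_diff)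
          qed
          finally have "real (card (supp X (d + 1 - k) g)) \<le> b k"
            using m by simp
          then have "P G \<sigma> g"
            using g False 1 by (auto simp: P_def contracts_def X_def k_def E_def)
          then show ?thesis by (rule exI[of _ g])
        next
          case 2
          obtain g where g: "\<And>S. S \<subseteq> X \<Longrightarrow> card S = 2 \<Longrightarrow> cobd g S = E S"
            and half: "2 * card (supp X 1 g) \<le> card X"
            and cut: "card (supp X 1 g) * (card X - card (supp X 1 g)) \<le> card (supp X 2 E)"
            using cut_filling[OF X(1) X_ne, of E] cocycle 2 by auto
          define s where "s = real (card (supp X 1 g))"
          define x where "x = real (card X)"
          have half: "2 * s \<le> x"
            using half unfolding s_def x_def by linarith
          then have "real (card (supp X 1 g) * (card X - card (supp X 1 g))) = s * (x - s)"
            by (simp add: s_def x_def of_nat_diff)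
          then have "s * (x - s) \<le> real (card (supp X 2 E))"
            using cut by (metis of_nat_le_iff)
          also have "\<dots> \<le> d * b (d - 1)"
            using E_small 2 by simp
          \<comment> \<open>The 2 in the denominator is \<open>fact (d + 1 - (d - 1))\<close>, the
            number of orderings of a pair.\<close>
          also have "\<dots> = A * fact d * fact (d + 1) / (2 * m ^ (d - 1))"
          proof -
            have "fact d = real d * fact (d - 1)"
              using d_pos by (simp add: fact_reduce)
            then show ?thesis
              using d_pos by (simp add: b_def numeral_2_eq_2)
          qed
          also have "\<dots> < d * m\<^sup>2 / (real d + 1)\<^sup>2"
          proof -
            have "m ^ (d + 1) = m\<^sup>2 * m ^ (d - 1)"
              using d_pos by (simp flip: power_add)
            then have "A * fact d * fact (d + 1) * (real d + 1)\<^sup>2 < d * m\<^sup>2 * (2 * m ^ (d - 1))"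
              using A by (simp add: m_def[symmetric] algebra_simps)
            then show ?thesis
              using m by (simp add: divide_simps del: fact_Suc)
          qed
          finally have "s * (x - s) < d * m\<^sup>2 / (real d + 1)\<^sup>2" .
          \<comment> \<open>The bound is the value of \<open>s * (m - s)\<close> at the critical
            size \<open>s = t\<close>. By
            \<open>(s - t) * (x - s - t) = s * (x - s) - t * (x - t)\<close> and
            \<open>2 * s \<le> x\<close>, a size of at least \<open>t\<close> would need too many
            pairs.\<close>
          moreover define t where "t = m / (real d + 1)"
          have "d * m\<^sup>2 / (real d + 1)\<^sup>2 = t * (m - t)"
            by (simp add: t_def field_simps power2_eq_square)
          moreover have "t * (m - t) \<le> t * (x - t)"
            using X m by (intro mult_left_mono) (auto simp: t_def x_def)
          moreover have "0 \<le> (s - t) * (x - s - t)" if "t \<le> s"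
            using that half by simp
          ultimately have "\<not> t \<le> s"
            by (auto simp: algebra_simps)
          then have "(real d + 1) * s < m"
            by (simp add: t_def field_simps)
          then have "P G \<sigma> g"
            using g False 2 by (auto simp: P_def contracts_def X_def k_def E_def s_def)
          then show ?thesis by (rule exI[of _ g])
        next
          case 3
          have k2: "k \<ge> 2"
            using 3 d_pos by simp
          have "(real d + 1) * real (card (supp X 1 E)) \<le>
              (real d + 1) * real (\<Sum>v\<in>\<sigma>. card (supp (H - N (\<sigma> - {v})) 1 (G (\<sigma> - {v}))))"
            using E_supp[OF k2, of 1] by (intro mult_left_mono) (auto simp del: of_nat_sum)
          also have "\<dots> = (\<Sum>v\<in>\<sigma>. (real d + 1) * real (card (supp (H - N (\<sigma> - {v})) 1 (G (\<sigma> - {v})))))"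
            by (simp add: sum_distrib_left)
          also have "\<dots> < (\<Sum>v\<in>\<sigma>. m)"
          proof (rule sum_strict_mono)
            fix v assume v: "v \<in> \<sigma>"
            then show "(real d + 1) * real (card (supp (H - N (\<sigma> - {v})) 1 (G (\<sigma> - {v})))) < m"
              using facet[OF v] facet_ne[OF k2 v] 3 unfolding P_def by auto
          qed (use \<sigma> in auto)
          also have "\<dots> = (real d + 1) * m"
            using 3 by (simp add: k_def)
          finally have "card (supp X 1 E) < card X"
            using X by (simp add: mult_less_cancel_left)
          then have "E {h} = 0" if "h \<in> X" for h
            using constant_cochain_eq_0[OF X(1) cocycle _ that] 3 by simp
          then have "P G \<sigma> (\<lambda>S. 0)"
            using 3 by (auto simp: P_def contracts_def k_def E_def X_def card_1_singleton_iff)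
          then show ?thesis by (rule exI[of _ "\<lambda>S. 0"])
        qed
      qed
    qed (auto simp: P_def)
  qed
  then show thesis
    using that unfolding P_def by blast
qed

text \<open>An acyclic carrier argument. The chain map \<open>L\<close> satisfies its equations on
  all subsets of \<open>H'\<close>, whereas \<open>G\<close> does so only on those avoiding
  \<open>N \<sigma>\<close>. The discrepancy is carried by sets that meet \<open>N \<sigma>\<close>,
  and coning from an apex in \<open>H' - N \<sigma>\<close> preserves this. The result is a
  null-homotopy of \<open>L\<close> over all of \<open>H'\<close> that still agrees with
  \<open>G\<close> away from the separators.\<close>

lemma extend_contraction:
  assumes G: "\<And>\<sigma>. \<sigma> \<in> K \<Longrightarrow> \<sigma> \<noteq> {} \<Longrightarrow> card \<sigma> \<le> d + 1 \<Longrightarrow> contracts G \<sigma> (G \<sigma>)"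
    and H': "H' \<subseteq> H" "card H' = d + 1"
    and L_vertex: "\<And>v. {v} \<in> K \<Longrightarrow> L {v} H' = F v H'"
    and L_closed: "\<And>\<sigma> S. \<sigma> \<in> K \<Longrightarrow> 2 \<le> card \<sigma> \<Longrightarrow> card \<sigma> \<le> d + 1 \<Longrightarrow> S \<subseteq> H' \<Longrightarrow>
      card S = d + 3 - card \<sigma> \<Longrightarrow> cobd (L \<sigma>) S = cobd (\<lambda>\<tau>. L \<tau> S) \<sigma>"
    and L_carried: "\<And>\<sigma> S. \<sigma> \<in> K \<Longrightarrow> 2 \<le> card \<sigma> \<Longrightarrow> card \<sigma> \<le> d + 1 \<Longrightarrow> S \<subseteq> H' - N \<sigma> \<Longrightarrow>
      card S = d + 2 - card \<sigma> \<Longrightarrow> L \<sigma> S = 0"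
    and L_outside: "\<And>\<sigma> S. \<sigma> \<in> K \<Longrightarrow> \<sigma> \<noteq> {} \<Longrightarrow> \<sigma> \<inter> B = {} \<Longrightarrow> L \<sigma> S = 0"
  obtains G' where "\<And>\<sigma> h. \<sigma> \<in> K \<Longrightarrow> card \<sigma> = d + 1 \<Longrightarrow> h \<in> H' \<Longrightarrow> cobd (\<lambda>\<tau>. G' \<tau> {h}) \<sigma> = L \<sigma> {h}"
    and "\<And>\<sigma>. \<sigma> \<in> K \<Longrightarrow> \<sigma> \<noteq> {} \<Longrightarrow> card \<sigma> \<le> d + 1 \<Longrightarrow> \<sigma> \<inter> B = {} \<Longrightarrow> G' \<sigma> = (\<lambda>T. 0)"
proof -
  have fin_H': "finite H'"
    using H' finite_H finite_subset by blast
  \<comment> \<open>Setting the value at the empty face to 0 makes the homotopy identity meaningful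
    for vertices, whose only facet is empty.\<close>
  define P where "P G' \<sigma> g \<longleftrightarrow> (\<sigma> = {} \<longrightarrow> g = (\<lambda>T. 0)) \<and>
      (\<sigma> \<in> K \<and> \<sigma> \<noteq> {} \<and> card \<sigma> \<le> d + 1 \<longrightarrow>
        (\<forall>S\<subseteq>H'. card S = d + 2 - card \<sigma> \<longrightarrow> cobd g S + cobd (\<lambda>\<tau>. G' \<tau> S) \<sigma> = L \<sigma> S) \<and>
        (\<forall>T\<subseteq>H' - N \<sigma>. card T = d + 1 - card \<sigma> \<longrightarrow> g T = G \<sigma> T) \<and>
        (\<sigma> \<inter> B = {} \<or> card \<sigma> = d + 1 \<longrightarrow> g = (\<lambda>T. 0)))"
    for G' :: "'v set \<Rightarrow> 'h set \<Rightarrow> bit" and \<sigma> g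
  have "\<exists>G'. \<forall>\<sigma>. P G' \<sigma> (G' \<sigma>)"
  proof (rule dependent_wf_choice[OF wf_finite_psubset])
    fix G1 G2 :: "'v set \<Rightarrow> 'h set \<Rightarrow> bit" and \<sigma> g
    assume "\<And>\<tau>. (\<tau>, \<sigma>) \<in> finite_psubset \<Longrightarrow> G1 \<tau> = G2 \<tau>"
    then have *: "G1 (\<sigma> - {v}) = G2 (\<sigma> - {v})" if "\<sigma> \<in> K" "v \<in> \<sigma>" for v
      using that face_finite by auto
    show "P G1 \<sigma> g = P G2 \<sigma> g"
    proof (cases "\<sigma> \<in> K")
      case True
      then have "cobd (\<lambda>\<tau>. G1 \<tau> S) \<sigma> = cobd (\<lambda>\<tau>. G2 \<tau> S) \<sigma>" for S
        using * face_finite by (intro cobd_cong) (auto simp: psubset_eq)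
      then show ?thesis
        by (simp add: P_def)
    qed (simp add: P_def)
  next
    fix \<sigma> and G' :: "'v set \<Rightarrow> 'h set \<Rightarrow> bit"
    assume IH: "\<And>\<tau>. (\<tau>, \<sigma>) \<in> finite_psubset \<Longrightarrow> P G' \<tau> (G' \<tau>)"
    show "\<exists>g. P G' \<sigma> g"
    proof (cases "\<sigma> \<in> K \<and> \<sigma> \<noteq> {} \<and> card \<sigma> \<le> d + 1")
      case True
      define k where "k = card \<sigma>"
      have \<sigma>: "\<sigma> \<in> K" "\<sigma> \<noteq> {}" "k \<le> d + 1" "finite \<sigma>"
        using True face_finite by (auto simp: k_def)
      then have k: "k \<ge> 1"
        by (simp add: k_def Suc_leI card_gt_0_iff)
      \<comment> \<open>The defect of \<open>G \<sigma>\<close> as a solution of the homotopy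
        identity. It vanishes on sets avoiding \<open>N \<sigma>\<close> and is a cocycle, so it can
        be coned off.\<close>
      define E where "E S = L \<sigma> S + (cobd (\<lambda>\<tau>. G' \<tau> S) \<sigma> + cobd (G \<sigma>) S)" for S
      have facet: "P G' (\<sigma> - {v}) (G' (\<sigma> - {v}))" "\<sigma> - {v} \<in> K" "card (\<sigma> - {v}) = k - 1"
        if "v \<in> \<sigma>" for v
        using IH[of "\<sigma> - {v}"] that \<sigma> face_subset by (auto simp: k_def)
      have facet_ne: "\<sigma> - {v} \<noteq> {}" if "k \<ge> 2" "v \<in> \<sigma>" for v
        using that Diff_singleton_nonempty by (simp add: k_def)
      have G\<sigma>: "contracts G \<sigma> (G \<sigma>)"
        using G \<sigma> by (simp add: k_def)
      have carried: "E S = 0" if S: "S \<subseteq> H' - N \<sigma>" "card S = d + 2 - k" for S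
      proof (cases "k = 1")
        case True
        then obtain v where v: "\<sigma> = {v}"
          unfolding k_def by (auto simp: card_1_singleton_iff)
        have "S = H'"
          using S True H' fin_H' by (intro card_subset_eq) auto
        moreover have "cobd (\<lambda>\<tau>. G' \<tau> S) \<sigma> = 0"
          using facet(1)[of v] by (simp add: v cobd_def P_def)
        moreover have "cobd (G \<sigma>) S = F v S"
          using G\<sigma> S H' True unfolding contracts_def v by (auto simp: N_singleton)
        ultimately show ?thesis
          using L_vertex[of v] \<sigma> by (simp add: E_def v)
      next
        case False
        then have k2: "k \<ge> 2"
          using k by simp
        have "cobd (\<lambda>\<tau>. G' \<tau> S) \<sigma> = cobd (\<lambda>\<tau>. G \<tau> S) \<sigma>"
        proof (rule cobd_cong)
          fix v assume v: "v \<in> \<sigma>"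
          have "S \<subseteq> H' - N (\<sigma> - {v})" "card S = d + 1 - (k - 1)" "k - 1 \<le> d + 1"
            using S N_mono[of "\<sigma> - {v}" \<sigma>] k2 \<sigma>(3) by auto
          then show "G' (\<sigma> - {v}) S = G (\<sigma> - {v}) S"
            using facet[OF v] facet_ne[OF k2 v] unfolding P_def by auto
        qed
        moreover have "cobd (G \<sigma>) S = cobd (\<lambda>\<tau>. G \<tau> S) \<sigma>"
        proof -
          have "S \<subseteq> H - N \<sigma>"
            using S H' by blast
          then have "cobd (G \<sigma>) S = boundary_cochain G \<sigma> S"
            using G\<sigma> S(2) unfolding contracts_def k_def by blast
          then show ?thesis
            using False by (simp add: boundary_cochain_def k_def)
        qed
        moreover have "L \<sigma> S = 0"
          using L_carried \<sigma> k2 S by (simp add: k_def)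
        ultimately show ?thesis
          by (simp add: E_def)
      qed
      have cocycle: "cobd E U = 0" if U: "U \<subseteq> H'" "card U = d + 3 - k" for U
      proof -
        have "k \<noteq> 1"
          using U H' fin_H' card_mono[of H' U] by auto
        then have k2: "k \<ge> 2"
          using k by simp
        have fin_U: "finite U"
          using U fin_H' finite_subset by blast
        have "cobd E U = cobd (L \<sigma>) U + (cobd (\<lambda>\<tau>. cobd (G' \<tau>) U) \<sigma> + cobd (cobd (G \<sigma>)) U)"
          unfolding E_def cobd_add cobd_swap[of G'] ..
        also have "cobd (\<lambda>\<tau>. cobd (G' \<tau>) U) \<sigma> = cobd (\<lambda>\<tau>. L \<tau> U + cobd (\<lambda>\<rho>. G' \<rho> U) \<tau>) \<sigma>"
        proof (rule cobd_cong)
          fix v assume v: "v \<in> \<sigma>"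
          have "card U = d + 2 - (k - 1)" "k - 1 \<le> d + 1"
            using U k2 \<sigma>(3) by auto
          then have "cobd (G' (\<sigma> - {v})) U + cobd (\<lambda>\<rho>. G' \<rho> U) (\<sigma> - {v}) = L (\<sigma> - {v}) U"
            using facet[OF v] facet_ne[OF k2 v] U(1) unfolding P_def by auto
          then show "cobd (G' (\<sigma> - {v})) U = L (\<sigma> - {v}) U + cobd (\<lambda>\<rho>. G' \<rho> U) (\<sigma> - {v})"
            by (metis add.assoc add_0_right bit_add_self)
        qed
        also have "\<dots> = cobd (\<lambda>\<tau>. L \<tau> U) \<sigma> + cobd (cobd (\<lambda>\<rho>. G' \<rho> U)) \<sigma>"
          by (rule cobd_add)
        finally show ?thesis
          using L_closed[of \<sigma> U] \<sigma> k2 U cobd_cobd[OF \<sigma>(4)] cobd_cobd[OF fin_U] by (simp add: k_def)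
      qed
      have "\<not> H' \<subseteq> N \<sigma>"
        using card_mono[OF finite_N[OF \<sigma>(1)], of H'] card_N[OF \<sigma>(1)] H' by auto
      then obtain x where x: "x \<in> H'" "x \<notin> N \<sigma>"
        by auto
      have G_top: "G \<sigma> = (\<lambda>T. 0)" if "\<sigma> \<inter> B = {} \<or> k = d + 1"
        using G\<sigma> that by (auto simp: contracts_def k_def)
      consider "\<sigma> \<inter> B = {}" | "\<sigma> \<inter> B \<noteq> {}" "k \<le> d" | "k = d + 1"
        using \<sigma>(3) by linarith
      then show ?thesis
      proof cases
        case 1
        have "cobd (\<lambda>\<tau>. G' \<tau> S) \<sigma> = 0" for S
        proof -
          have "G' (\<sigma> - {v}) S = 0" if v: "v \<in> \<sigma>" for v
          proof (cases "\<sigma> - {v} = {}")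
            case False
            moreover have "(\<sigma> - {v}) \<inter> B = {}" "k - 1 \<le> d + 1"
              using 1 \<sigma>(3) by auto
            ultimately show ?thesis
              using facet[OF v] unfolding P_def by auto
          qed (use facet(1)[OF v] in \<open>auto simp: P_def\<close>)
          then show ?thesis
            by (simp add: cobd_def)
        qed
        then have "P G' \<sigma> (\<lambda>T. 0)"
          using L_outside[OF \<sigma>(1,2) 1] G_top 1 \<sigma> by (simp add: P_def)
        then show ?thesis by (rule exI[of _ "\<lambda>T. 0"])
      next
        case 2
        define g where "g T = G \<sigma> T + cone_off x E T" for T
        have "cobd g S + cobd (\<lambda>\<tau>. G' \<tau> S) \<sigma> = L \<sigma> S" if S: "S \<subseteq> H'" "card S = d + 2 - card \<sigma>" for S
        proof -
          have fin_S: "finite S"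
            using S fin_H' finite_subset by blast
          have "cobd (cone_off x E) S = E S"
          proof (rule cobd_cone_off[OF fin_S])
            assume "x \<notin> S"
            then show "cobd E (insert x S) = 0"
              using S x fin_S \<sigma>(3) by (intro cocycle) (auto simp: k_def)
          qed
          then have "cobd g S + cobd (\<lambda>\<tau>. G' \<tau> S) \<sigma> = (cobd (G \<sigma>) S + E S) + cobd (\<lambda>\<tau>. G' \<tau> S) \<sigma>"
            unfolding g_def cobd_add by simp
          also have "\<dots> = L \<sigma> S"
            unfolding E_def
            by (cases "cobd (G \<sigma>) S"; cases "cobd (\<lambda>\<tau>. G' \<tau> S) \<sigma>"; cases "L \<sigma> S") auto
          finally show ?thesis .
        qed
        moreover have "g T = G \<sigma> T" if T: "T \<subseteq> H' - N \<sigma>" "card T = d + 1 - card \<sigma>" for T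
        proof -
          have "finite T"
            using T fin_H' finite_subset by blast
          \<comment> \<open>Adding the apex to a set that avoids \<open>N \<sigma>\<close> gives
            another such set, so the correction is invisible there.\<close>
          then have "E (insert x T) = 0" if "x \<notin> T"
            using that T x 2 by (intro carried) (auto simp: k_def)
          then show ?thesis
            by (simp add: g_def cone_off_def)
        qed
        ultimately have "P G' \<sigma> g"
          using 2 \<sigma> by (simp add: P_def k_def)
        then show ?thesis by (rule exI[of _ g])
      next
        case 3
        \<comment> \<open>In top degree nothing is left to correct with, but the defect is constant
          on singletons and vanishes at the nonseparating hyperplane \<open>x\<close>.\<close>
        have E_x: "E {x} = 0"
          using x 3 by (intro carried) auto
        have "E {h} = 0" if h: "h \<in> H'" for h
        proof (cases "h = x")
          case False
          then have "E {h} + E {x} = cobd E {h, x}"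
            by (simp add: cobd_pair)
          also have "\<dots> = 0"
            using False h x 3 by (intro cocycle) auto
          finally show ?thesis
            using E_x by simp
        qed (use E_x in simp)
        moreover have "E S = cobd (\<lambda>\<tau>. G' \<tau> S) \<sigma> + L \<sigma> S" for S
          using G_top 3 by (simp add: E_def add.commute)
        ultimately have "cobd (\<lambda>\<tau>. G' \<tau> {h}) \<sigma> = L \<sigma> {h}" if "h \<in> H'" for h
          using that bit_eq_iff_add by metis
        then have "P G' \<sigma> (\<lambda>T. 0)"
          using \<sigma> G_top 3 by (auto simp: P_def k_def card_1_singleton_iff)
        then show ?thesis by (rule exI[of _ "\<lambda>T. 0"])
      qed
    qed (auto simp: P_def)
  qed
  then obtain G' where G': "\<And>\<sigma>. P G' \<sigma> (G' \<sigma>)"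
    by blast
  show thesis
  proof (rule that)
    fix \<sigma> h assume \<sigma>: "\<sigma> \<in> K" "card \<sigma> = d + 1" and h: "h \<in> H'"
    then have "\<sigma> \<noteq> {}"
      by auto
    with G'[of \<sigma>] \<sigma> h have "cobd (G' \<sigma>) {h} + cobd (\<lambda>\<tau>. G' \<tau> {h}) \<sigma> = L \<sigma> {h}" "G' \<sigma> = (\<lambda>T. 0)"
      by (auto simp: P_def)
    then show "cobd (\<lambda>\<tau>. G' \<tau> {h}) \<sigma> = L \<sigma> {h}"
      by simp
  qed (use G' in \<open>auto simp: P_def\<close>)
qed

end

section \<open>Labellings of the Kuhn triangulation\<close>

lemma sum_facets_with_label_set:
  assumes \<sigma>: "finite \<sigma>" "card \<sigma> = Suc (card T)" and T: "finite T"
  shows "(\<Sum>v\<in>\<sigma>. of_bool (f ` (\<sigma> - {v}) = T)) = (of_bool (\<exists>t. t \<notin> T \<and> f ` \<sigma> = insert t T) :: bit)"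
proof -
  have sum: "(\<Sum>v\<in>\<sigma>. of_bool (f ` (\<sigma> - {v}) = T)) = (of_nat (card {v \<in> \<sigma>. f ` (\<sigma> - {v}) = T}) :: bit)"
    using \<sigma>(1) by (simp add: of_bool_def sum.If_cases Int_def)
  have image: "f ` \<sigma> = insert (f v) T" if "v \<in> \<sigma>" "f ` (\<sigma> - {v}) = T" for v
    using that by auto
  show ?thesis
  proof (cases "inj_on f \<sigma>")
    case True
    have notin: "f v \<notin> f ` (\<sigma> - {v})" if "v \<in> \<sigma>" for v
      using that True by (auto simp: inj_on_def)
    show ?thesis
    proof (cases "\<exists>t. t \<notin> T \<and> f ` \<sigma> = insert t T")
      case True
      then obtain t where t: "t \<notin> T" "f ` \<sigma> = insert t T"
        by auto
      then obtain v where v: "v \<in> \<sigma>" "f v = t"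
        by (metis imageE insertI1)
      have "{w \<in> \<sigma>. f ` (\<sigma> - {w}) = T} = {v}"
      proof (intro equalityI subsetI)
        fix w assume "w \<in> {w \<in> \<sigma>. f ` (\<sigma> - {w}) = T}"
        then have "w \<in> \<sigma>" "f w = t"
          using t image[of w] notin[of w] by auto
        then show "w \<in> {v}"
          using v \<open>inj_on f \<sigma>\<close> by (auto simp: inj_on_def)
      next
        fix w assume "w \<in> {v}"
        moreover have "f ` (\<sigma> - {v}) = f ` \<sigma> - {f v}"
          using notin[OF v(1)] by (auto simp: image_iff) (metis DiffI singletonD)
        then have "f ` (\<sigma> - {v}) = T"
          using v t by simp
        ultimately show "w \<in> {w \<in> \<sigma>. f ` (\<sigma> - {w}) = T}"
          using v by auto
      qed
      then show ?thesis
        using True by (simp add: sum)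
    next
      case False
      then have "{v \<in> \<sigma>. f ` (\<sigma> - {v}) = T} = {}"
        using image notin by blast
      then show ?thesis
        using False by (simp add: sum)
    qed
  next
    case False
    then have card_less: "card (f ` \<sigma>) \<le> card T"
      using \<sigma> by (metis card_image_le eq_card_imp_inj_on le_SucE)
    have rhs: "\<not> (\<exists>t. t \<notin> T \<and> f ` \<sigma> = insert t T)"
      using card_less T by auto
    have "even (card {v \<in> \<sigma>. f ` (\<sigma> - {v}) = T})"
    proof (cases "f ` \<sigma> = T")
      case True
      obtain a b where ab: "a \<in> \<sigma>" "b \<in> \<sigma>" "a \<noteq> b" "f a = f b"
        using False by (auto simp: inj_on_def)
      have "\<sigma> = insert b (\<sigma> - {a, b} \<union> {a})" "\<sigma> - {a} = insert b (\<sigma> - {a, b})"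
        "\<sigma> - {b} = insert a (\<sigma> - {a, b})"
        using ab by auto
      then have "f ` (\<sigma> - {a}) = f ` \<sigma>" "f ` (\<sigma> - {b}) = f ` \<sigma>"
        using ab(4) by (metis Un_insert_right image_insert insert_absorb2 sup_bot_right)+
      moreover have "f ` (\<sigma> - {v}) \<noteq> T" if v: "v \<in> \<sigma>" "v \<noteq> a" "v \<noteq> b" for v
      proof
        assume "f ` (\<sigma> - {v}) = T"
        then have "inj_on f (\<sigma> - {v})"
          using \<sigma> v by (intro eq_card_imp_inj_on) auto
        then show False
          using ab v by (auto simp: inj_on_def)
      qed
      ultimately have "{v \<in> \<sigma>. f ` (\<sigma> - {v}) = T} = {a, b}"
        using ab True by auto
      then show ?thesis
        using ab by simp
    next
      case False
      have "f ` (\<sigma> - {v}) \<noteq> T" if "v \<in> \<sigma>" for v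
        using image[OF that] rhs False by (metis insert_absorb)
      then have "{v \<in> \<sigma>. f ` (\<sigma> - {v}) = T} = {}"
        by auto
      then show ?thesis
        by (metis card.empty even_zero)
    qed
    then obtain m where "card {v \<in> \<sigma>. f ` (\<sigma> - {v}) = T} = m + m"
      by (metis evenE mult_2)
    then have "(of_nat (card {v \<in> \<sigma>. f ` (\<sigma> - {v}) = T}) :: bit) = 0"
      by (simp only: of_nat_add bit_add_self)
    moreover have "(of_bool (\<exists>t. t \<notin> T \<and> f ` \<sigma> = insert t T) :: bit) = 0"
      using rhs by simp
    ultimately show ?thesis
      using sum by (simp only:)
  qed
qed

text \<open>Sets of hyperplanes are identified with their complements, which turns coboundaries into boundaries.
  So this is the simplicial chain map of the labelling \<open>f\<close>, with values in the cone with apex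
  \<open>None\<close> over the simplex \<open>H\<close>.\<close>

definition label_cochain :: "('v \<Rightarrow> 'h option) \<Rightarrow> 'h set \<Rightarrow> 'v set \<Rightarrow> 'h set \<Rightarrow> bit" where
  "label_cochain f H \<sigma> S = of_bool (f ` \<sigma> = insert None (Some ` (H - S)))"

text \<open>Both sides detect whether \<open>\<sigma>\<close> carries the labels in \<open>T\<close>
  and exactly one more: removing \<open>s\<close> from \<open>S\<close> adds the label
  \<open>s\<close> to the required set, while on the right a vertex is dropped instead. The extra
  label must come from \<open>S\<close>, because \<open>T\<close> contains all other admissible
  ones.\<close>

lemma cobd_label_cochain:
  assumes H: "finite H" and \<sigma>: "finite \<sigma>" "f ` \<sigma> \<subseteq> insert None (Some ` H)"
    and S: "S \<subseteq> H" "card \<sigma> + card S = card H + 2"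
  shows "cobd (label_cochain f H \<sigma>) S = cobd (\<lambda>\<tau>. label_cochain f H \<tau> S) \<sigma>"
proof -
  define T where "T = insert None (Some ` (H - S))"
  have fin: "finite T" "finite S"
    using H S by (auto simp: T_def finite_subset)
  have "card T = Suc (card (H - S))"
    using H by (simp add: T_def card_image)
  also have "\<dots> = Suc (card H - card S)"
    using H S fin by (simp add: card_Diff_subset)
  finally have card_T: "card \<sigma> = Suc (card T)"
    using S card_mono[OF H S(1)] by simp
  have "cobd (\<lambda>\<tau>. label_cochain f H \<tau> S) \<sigma> = of_bool (\<exists>t. t \<notin> T \<and> f ` \<sigma> = insert t T)"
    unfolding cobd_def label_cochain_def T_def[symmetric]
    by (rule sum_facets_with_label_set) (use \<sigma> fin card_T in auto)
  moreover have "cobd (label_cochain f H \<sigma>) S = (\<Sum>s\<in>S. of_bool (f ` \<sigma> = insert (Some s) T))"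
  proof -
    have "insert None (Some ` (H - (S - {s}))) = insert (Some s) T" if "s \<in> S" for s
      using S that by (auto simp: T_def)
    then show ?thesis
      by (simp add: cobd_def label_cochain_def)
  qed
  moreover have "(\<Sum>s\<in>S. of_bool (f ` \<sigma> = insert (Some s) T)) =
      (of_bool (\<exists>t. t \<notin> T \<and> f ` \<sigma> = insert t T) :: bit)"
  proof (cases "\<exists>t. t \<notin> T \<and> f ` \<sigma> = insert t T")
    case True
    then obtain t where t: "t \<notin> T" "f ` \<sigma> = insert t T"
      by auto
    then have "t \<in> insert None (Some ` H)"
      using \<sigma> by auto
    then obtain s where s: "t = Some s" "s \<in> S"
      using t by (auto simp: T_def)
    have "f ` \<sigma> = insert (Some s') T \<longleftrightarrow> s' = s" if "s' \<in> S" for s'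
      using t s that by (auto simp: T_def)
    then have "(\<Sum>s'\<in>S. of_bool (f ` \<sigma> = insert (Some s') T)) = (\<Sum>s'\<in>S. of_bool (s' = s) :: bit)"
      by (intro sum.cong) auto
    also have "\<dots> = 1"
      using fin s by (simp add: of_bool_def sum.delta)
    finally show ?thesis
      using True by simp
  next
    case False
    then have "f ` \<sigma> \<noteq> insert (Some s) T" if "s \<in> S" for s
      using that by (auto simp: T_def)
    then show ?thesis
      using False by simp
  qed
  ultimately show ?thesis
    by simp
qed

section \<open>The Kuhn triangulation and the pairing of its facets\<close>

definition lattice :: "nat \<Rightarrow> (nat \<Rightarrow> int) set" where
  "lattice d = {x. \<forall>i. i \<notin> {1..d} \<longrightarrow> x i = 0}"

definition perms :: "nat \<Rightarrow> nat list set" where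
  "perms d = {p. distinct p \<and> set p = {1..d}}"

text \<open>The \<open>k\<close>-th point of the lattice path that starts at \<open>x\<close> and
  raises the coordinates by 1 in the order given by \<open>p\<close>. The paths through all
  directions span the simplices of the triangulation.\<close>

definition kvert :: "(nat \<Rightarrow> int) \<Rightarrow> nat list \<Rightarrow> nat \<Rightarrow> nat \<Rightarrow> int" where
  "kvert x p k = (\<lambda>i. x i + of_bool (i \<in> set (take k p)))"

definition ksimp :: "nat \<Rightarrow> (nat \<Rightarrow> int) \<Rightarrow> nat list \<Rightarrow> (nat \<Rightarrow> int) set" where
  "ksimp d x p = kvert x p ` {..d}"

lemma length_perms: "p \<in> perms d \<Longrightarrow> length p = d"
  by (metis (mono_tags, lifting) card_atLeastAtMost diff_Suc_1 distinct_card mem_Collect_eq perms_def)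

lemma finite_perms: "finite (perms d)"
proof (rule finite_subset)
  show "perms d \<subseteq> {p. set p \<subseteq> {1..d} \<and> length p = d}"
    using length_perms by (auto simp: perms_def)
qed (simp add: finite_lists_length_eq)

lemma card_take_perms: "p \<in> perms d \<Longrightarrow> k \<le> d \<Longrightarrow> card (set (take k p)) = k"
  using length_perms[of p d] by (simp add: perms_def distinct_card)

lemma inj_on_kvert: "p \<in> perms d \<Longrightarrow> inj_on (kvert x p) {..d}"
proof (rule inj_onI)
  fix j k assume p: "p \<in> perms d" and jk: "j \<in> {..d}" "k \<in> {..d}" "kvert x p j = kvert x p k"
  have "i \<in> set (take j p) \<longleftrightarrow> i \<in> set (take k p)" for i
    using fun_cong[OF jk(3), of i] by (simp add: kvert_def of_bool_def split: if_splits)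
  then have "set (take j p) = set (take k p)"
    by auto
  then show "j = k"
    using card_take_perms[OF p] jk by (metis atMost_iff)
qed

lemma finite_ksimp: "finite (ksimp d x p)"
  by (simp add: ksimp_def)

lemma card_ksimp: "p \<in> perms d \<Longrightarrow> card (ksimp d x p) = d + 1"
  by (simp add: ksimp_def card_image inj_on_kvert)

lemma kvert_lattice: "x \<in> lattice d \<Longrightarrow> p \<in> perms d \<Longrightarrow> kvert x p k \<in> lattice d"
  by (auto simp: lattice_def perms_def kvert_def dest: in_set_takeD)

text \<open>Replaces the vertex number \<open>k\<close> by the unique other one that yields a Kuhn simplex. Replacing the first
  or last vertex shifts the flag cyclically.\<close>

fun flip :: "nat \<Rightarrow> (nat \<Rightarrow> int) \<times> nat list \<times> nat \<Rightarrow> (nat \<Rightarrow> int) \<times> nat list \<times> nat" where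
  "flip d (x, p, k) =
     (if k = 0 then (\<lambda>i. x i + of_bool (i = hd p), tl p @ [hd p], d)
      else if k = d then (\<lambda>i. x i - of_bool (i = last p), last p # butlast p, 0)
      else (x, p[k - 1 := p ! k, k := p ! (k - 1)], k))"

definition kfacet :: "nat \<Rightarrow> (nat \<Rightarrow> int) \<times> nat list \<times> nat \<Rightarrow> (nat \<Rightarrow> int) set" where
  "kfacet d = (\<lambda>(x, p, k). kvert x p ` ({..d} - {k}))"

definition kflags :: "nat \<Rightarrow> ((nat \<Rightarrow> int) \<times> nat list \<times> nat) set" where
  "kflags d = lattice d \<times> perms d \<times> {..d}"

lemma kfacet_flip_0:
  assumes d: "d \<ge> 1" and p: "p \<in> perms d"
  shows "kfacet d (flip d (x, p, 0)) = kfacet d (x, p, 0)"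
proof -
  obtain a q where p_eq: "p = a # q"
    using d length_perms[OF p] by (cases p) auto
  have q: "length q = d - 1" "a \<notin> set q"
    using length_perms[OF p] p p_eq by (auto simp: perms_def)
  have "kvert (\<lambda>i. x i + of_bool (i = a)) (q @ [a]) j = kvert x p (Suc j)" if "j < d" for j
    using that q by (auto simp: kvert_def p_eq fun_eq_iff dest: in_set_takeD)
  then have "kvert (\<lambda>i. x i + of_bool (i = a)) (q @ [a]) ` {..<d} = kvert x p ` Suc ` {..<d}"
    by (simp add: image_image)
  moreover have "{..d} - {d} = {..<d}" "{..d} - {0} = Suc ` {..<d}"
    by (auto simp: image_iff) (metis Suc_le_eq Suc_pred lessThan_iff neq0_conv)
  ultimately show ?thesis
    by (simp add: kfacet_def p_eq)
qed

text \<open>At an inner vertex the two adjacent directions are exchanged, which alters the prefix of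
  length \<open>k\<close> but no other prefix as a set. Dropping the start lets the path begin one
  step later and repeat its first direction at the end; dropping the end is the inverse
  operation.\<close>

lemma flip:
  assumes d: "d \<ge> 1" and z: "z \<in> kflags d"
  shows "flip d z \<in> kflags d" "flip d (flip d z) = z" "flip d z \<noteq> z" "kfacet d (flip d z) = kfacet d z"
proof -
  obtain x p k where z_eq: "z = (x, p, k)"
    by (cases z)
  have x: "x \<in> lattice d" and p: "p \<in> perms d" and k: "k \<le> d"
    using z by (auto simp: z_eq kflags_def)
  have len: "length p = d"
    using p by (rule length_perms)
  have p_ne: "p \<noteq> []"
    using len d by auto
  consider "k = 0" | "k \<noteq> 0" "k = d" | "k \<noteq> 0" "k < d"
    using k by linarith
  then have "flip d z \<in> kflags d \<and> flip d (flip d z) = z \<and> flip d z \<noteq> z \<and> kfacet d (flip d z) = kfacet d z"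
  proof cases
    case 1
    obtain a q where p_eq: "p = a # q"
      using p_ne by (cases p) auto
    show ?thesis
      using x p d 1 kfacet_flip_0[OF d p, of x]
      by (auto simp: z_eq kflags_def p_eq lattice_def perms_def)
  next
    case 2
    obtain a q where p_eq: "p = q @ [a]"
      using p_ne by (cases p rule: rev_cases) auto
    define x' where "x' = (\<lambda>i. x i - of_bool (i = a))"
    have flip_z: "flip d z = (x', a # q, 0)" and flip_back: "flip d (x', a # q, 0) = z"
      using 2 by (simp_all add: z_eq p_eq x'_def)
    have "a # q \<in> perms d"
      using p by (auto simp: perms_def p_eq)
    then show ?thesis
      using x p d 2 kfacet_flip_0[of d "a # q" x'] flip_back
      by (auto simp: flip_z kflags_def lattice_def z_eq perms_def x'_def p_eq)
  next
    case 3
    define q where "q = p[k - 1 := p ! k, k := p ! (k - 1)]"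
    have flip_z: "flip d z = (x, q, k)"
      using 3 by (simp add: z_eq q_def)
    have set_q: "set q = set p" "distinct q" "length q = d"
      using 3 len p unfolding q_def
      by (auto simp: perms_def set_swap intro: distinct_swap[THEN iffD2])
    have q_back: "q[k - 1 := q ! k, k := q ! (k - 1)] = p"
      using 3 len unfolding q_def by (intro nth_equalityI) (auto simp: nth_list_update)
    have "q ! k = p ! (k - 1)"
      using 3 len by (simp add: q_def)
    moreover have "p ! (k - 1) \<noteq> p ! k"
      using p 3 len by (auto simp: perms_def nth_eq_iff_index_eq)
    ultimately have "q \<noteq> p"
      by auto
    have "set (take j q) = set (take j p)" if "j \<noteq> k" for j
    proof (cases "j < k")
      case True
      then show ?thesis
        by (simp add: q_def)
    next
      case False
      then have "take j q = (take j p)[k - 1 := take j p ! k, k := take j p ! (k - 1)]"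
        using that 3 by (simp add: q_def take_update_swap)
      then show ?thesis
        using set_swap[of "k - 1" "take j p" k] False that 3 len by (simp add: less_imp_diff_less)
    qed
    then have "kvert x q ` ({..d} - {k}) = kvert x p ` ({..d} - {k})"
      by (intro image_cong) (auto simp: kvert_def)
    then have "kfacet d (x, q, k) = kfacet d z"
      by (simp add: z_eq kfacet_def)
    moreover have "flip d (x, q, k) = z"
      using 3 q_back by (simp add: z_eq)
    moreover have "(x, q, k) \<in> kflags d"
      using set_q p x k by (simp add: kflags_def perms_def)
    moreover have "(x, q, k) \<noteq> z"
      using \<open>q \<noteq> p\<close> by (simp add: z_eq)
    ultimately show ?thesis
      unfolding flip_z by blast
  qed
  then show "flip d z \<in> kflags d" "flip d (flip d z) = z" "flip d z \<noteq> z" "kfacet d (flip d z) = kfacet d z"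
    by auto
qed

lemma finite_ksimps_meeting:
  assumes "finite B"
  shows "finite {(x, p). p \<in> perms d \<and> ksimp d x p \<inter> B \<noteq> {}}"
proof (rule finite_subset)
  show "{(x, p). p \<in> perms d \<and> ksimp d x p \<inter> B \<noteq> {}} \<subseteq>
      (\<lambda>(b, p, k). (\<lambda>i. b i - of_bool (i \<in> set (take k p)), p)) ` (B \<times> perms d \<times> {..d})"
  proof clarify
    fix x p assume p: "p \<in> perms d" and "ksimp d x p \<inter> B \<noteq> {}"
    then obtain k where k: "k \<le> d" "kvert x p k \<in> B"
      by (auto simp: ksimp_def)
    have "(x, p) = (\<lambda>(b, p, k). (\<lambda>i. b i - of_bool (i \<in> set (take k p)), p)) (kvert x p k, p, k)"
      by (simp add: kvert_def)
    then show "(x, p) \<in> (\<lambda>(b, p, k). (\<lambda>i. b i - of_bool (i \<in> set (take k p)), p)) ` (B \<times> perms d \<times> {..d})"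
      using k p by (intro image_eqI) auto
  qed
qed (use assms finite_perms in auto)

text \<open>The flags cancel modulo 2 in the pairs formed by \<open>flip\<close>. A facet that meets
  \<open>B\<close> has both of its simplices in the finite index set, and all other facets have
  value 0, so cutting off the infinite triangulation leaves nothing unpaired.\<close>

lemma sum_cobd_ksimp_eq_0:
  assumes d: "d \<ge> 1" and B: "finite B"
    and g: "\<And>z. z \<in> kflags d \<Longrightarrow> kfacet d z \<inter> B = {} \<Longrightarrow> g (kfacet d z) = 0"
  shows "(\<Sum>(x, p) | x \<in> lattice d \<and> p \<in> perms d \<and> ksimp d x p \<inter> B \<noteq> {}. cobd g (ksimp d x p)) = 0"
proof -
  define W where "W = {(x, p). x \<in> lattice d \<and> p \<in> perms d \<and> ksimp d x p \<inter> B \<noteq> {}}"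
  have W: "finite W"
    by (rule finite_subset[OF _ finite_ksimps_meeting[OF B, of d]]) (auto simp: W_def)
  have cobd: "cobd g (ksimp d x p) = (\<Sum>k\<le>d. g (kfacet d (x, p, k)))" if "(x, p) \<in> W" for x p
  proof -
    have inj: "inj_on (kvert x p) {..d}"
      using that by (simp add: W_def inj_on_kvert)
    have "cobd g (ksimp d x p) = (\<Sum>k\<le>d. g (ksimp d x p - {kvert x p k}))"
      unfolding cobd_def ksimp_def by (rule sum.reindex[OF inj, unfolded o_def])
    also have "\<dots> = (\<Sum>k\<le>d. g (kfacet d (x, p, k)))"
    proof (rule sum.cong)
      fix k assume "k \<in> {..d}"
      then show "g (ksimp d x p - {kvert x p k}) = g (kfacet d (x, p, k))"
        using inj by (simp add: ksimp_def kfacet_def inj_on_image_set_diff[OF inj])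
    qed simp
    finally show ?thesis .
  qed
  define Z where "Z = {z \<in> kflags d. kfacet d z \<inter> B \<noteq> {}}"
  have "(\<Sum>(x, p)\<in>W. cobd g (ksimp d x p)) = (\<Sum>(x, p)\<in>W. \<Sum>k\<le>d. g (kfacet d (x, p, k)))"
    by (intro sum.cong) (auto simp: cobd)
  also have "\<dots> = (\<Sum>w\<in>W. \<Sum>k\<le>d. g (kfacet d (fst w, snd w, k)))"
    by (simp add: case_prod_beta)
  also have "\<dots> = (\<Sum>(w, k)\<in>W \<times> {..d}. g (kfacet d (fst w, snd w, k)))"
    by (rule sum.cartesian_product)
  also have "\<dots> = (\<Sum>z\<in>(\<lambda>(w, k). (fst w, snd w, k)) ` (W \<times> {..d}). g (kfacet d z))"
    by (subst sum.reindex) (auto simp: inj_on_def case_prod_beta prod_eq_iff)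
  also have "\<dots> = (\<Sum>z\<in>Z. g (kfacet d z))"
  proof (rule sum.mono_neutral_right)
    show "Z \<subseteq> (\<lambda>(w, k). (fst w, snd w, k)) ` (W \<times> {..d})"
    proof
      fix z assume z: "z \<in> Z"
      obtain x p k where z_eq: "z = (x, p, k)"
        by (cases z)
      have "((x, p), k) \<in> W \<times> {..d}"
        using z by (auto simp: z_eq Z_def W_def kflags_def kfacet_def ksimp_def)
      then show "z \<in> (\<lambda>(w, k). (fst w, snd w, k)) ` (W \<times> {..d})"
        by (rule rev_image_eqI) (simp add: z_eq)
    qed
    show "\<forall>z\<in>(\<lambda>(w, k). (fst w, snd w, k)) ` (W \<times> {..d}) - Z. g (kfacet d z) = 0"
      using g by (auto simp: Z_def W_def kflags_def)
  qed (use W in simp)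
  also have "\<dots> = 0"
    by (rule sum_involution_eq_0[where h = "flip d"]) (use flip[OF d] in \<open>auto simp: Z_def\<close>)
  finally show ?thesis
    by (simp add: W_def)
qed

section \<open>The cyclic labelling and its unique fully labelled simplex\<close>

definition nonneg_side :: "nat \<Rightarrow> int \<Rightarrow> (nat \<Rightarrow> int) \<Rightarrow> nat \<Rightarrow> bool" where
  "nonneg_side d M v i \<longleftrightarrow> (if i = 0 then (\<Sum>j = 1..d. v j) \<le> M else 0 \<le> v i)"

definition cyc :: "nat \<Rightarrow> nat \<Rightarrow> nat" where
  "cyc d i = (if i = d then 0 else Suc i)"

lemma cyc_closed_imp:
  assumes "i \<le> d" "Q i" and step: "\<And>j. j \<le> d \<Longrightarrow> Q j \<Longrightarrow> Q (cyc d j)" and "k \<le> d"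
  shows "Q k"
proof -
  have up: "Q m" if "j \<le> m" "m \<le> d" "Q j" for j m
    using that
  proof (induction m rule: dec_induct)
    case (step n)
    then show ?case
      using assms(3)[of n] by (simp add: cyc_def)
  qed simp
  have "Q 0"
    using up[of i d] assms step[of d] by (simp add: cyc_def)
  then show ?thesis
    using up[of 0 k] \<open>k \<le> d\<close> by simp
qed

text \<open>The point is in the interior of the simplex (\<open>None\<close>), or it is on the wrong side of
  the wall that cyclically follows its label. Hence a set of labels that contains all
  walls separating the vertices of a simplex is cyclically closed, so it contains all walls.\<close>

definition lab :: "nat \<Rightarrow> int \<Rightarrow> (nat \<Rightarrow> int) \<Rightarrow> nat option" where
  "lab d M v = (if \<forall>i\<le>d. nonneg_side d M v i then None
     else Some (LEAST i. i \<le> d \<and> nonneg_side d M v i \<and> \<not> nonneg_side d M v (cyc d i)))"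

lemma lab_None_iff: "lab d M v = None \<longleftrightarrow> (\<forall>i\<le>d. nonneg_side d M v i)"
  by (simp add: lab_def)

text \<open>A label exists because not all inequalities can fail: negative coordinates have a sum
  below \<open>M\<close>. So somewhere in the cyclic order of the walls, a satisfied one is followed
  by a violated one.\<close>

lemma lab_Some:
  assumes M: "M \<ge> 0" and lab: "lab d M v = Some i"
  shows "i \<le> d" "nonneg_side d M v i" "\<not> nonneg_side d M v (cyc d i)"
    and "\<And>j. j < i \<Longrightarrow> nonneg_side d M v j \<Longrightarrow> nonneg_side d M v (cyc d j)"
proof -
  define Q where "Q i \<longleftrightarrow> i \<le> d \<and> nonneg_side d M v i \<and> \<not> nonneg_side d M v (cyc d i)" for i
  have i: "i = (LEAST i. Q i)" and not_all: "\<not> (\<forall>i\<le>d. nonneg_side d M v i)"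
    using lab unfolding lab_def Q_def by (auto split: if_splits)
  have "\<exists>i\<le>d. nonneg_side d M v i"
  proof (cases "\<exists>i\<in>{1..d}. 0 \<le> v i")
    case False
    then have "(\<Sum>j = 1..d. v j) \<le> 0"
      by (intro sum_nonpos) force
    then have "nonneg_side d M v 0"
      using M by (simp add: nonneg_side_def)
    then show ?thesis
      by blast
  next
    case True
    then obtain i where "i \<in> {1..d}" "0 \<le> v i"
      by blast
    then show ?thesis
      by (intro exI[of _ i]) (auto simp: nonneg_side_def)
  qed
  then have "\<exists>i. Q i"
    using not_all cyc_closed_imp[of _ d "nonneg_side d M v"] unfolding Q_def by blast
  then have "Q i"
    unfolding i by (rule LeastI_ex)
  then show "i \<le> d" "nonneg_side d M v i" "\<not> nonneg_side d M v (cyc d i)"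
    by (auto simp: Q_def)
  fix j assume "j < i" "nonneg_side d M v j"
  then show "nonneg_side d M v (cyc d j)"
    using not_less_Least[of j Q] \<open>i \<le> d\<close> unfolding i[symmetric] by (auto simp: Q_def)
qed

lemma lab_eqI:
  assumes "i \<le> d" "nonneg_side d M v i" "\<not> nonneg_side d M v (cyc d i)"
    and "\<And>j. j < i \<Longrightarrow> nonneg_side d M v (cyc d j)"
  shows "lab d M v = Some i"
proof -
  have "cyc d i \<le> d"
    using assms(1) by (auto simp: cyc_def)
  then have "\<not> (\<forall>i\<le>d. nonneg_side d M v i)"
    using assms(3) by blast
  moreover have "(LEAST i. i \<le> d \<and> nonneg_side d M v i \<and> \<not> nonneg_side d M v (cyc d i)) = i"
    using assms by (intro Least_equality) (auto simp: not_less[symmetric])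
  ultimately show ?thesis
    by (simp add: lab_def)
qed

lemma sum_kvert:
  assumes p: "p \<in> perms d" and "k \<le> d"
  shows "(\<Sum>j = 1..d. kvert x p k j) = (\<Sum>j = 1..d. x j) + int k"
proof -
  have "{1..d} \<inter> set (take k p) = set (take k p)"
    using p by (auto simp: perms_def dest: in_set_takeD)
  then have "(\<Sum>j = 1..d. of_bool (j \<in> set (take k p)) :: int) = int k"
    using card_take_perms[OF assms] by simp
  then show ?thesis
    by (simp add: kvert_def sum.distrib)
qed

text \<open>The start of the unique fully labelled path. From \<open>(M, -1, ..., -1)\<close> the
  entries -1 are raised to 0 in order, giving the labels \<open>1, ..., d - 2 + 1\<close> in turn,
  until the interior point \<open>(M, 0, ..., 0)\<close> is reached; raising the first coordinate
  last leaves the simplex through wall 0 and gives the label \<open>d\<close>.\<close>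

definition corner :: "nat \<Rightarrow> int \<Rightarrow> nat \<Rightarrow> int" where
  "corner d M i = (if i = 1 then M else if i \<in> {2..d} then - 1 else 0)"

lemma corner_lattice: "d \<ge> 1 \<Longrightarrow> corner d M \<in> lattice d"
  by (auto simp: lattice_def corner_def)

lemma corner_perm: "d \<ge> 1 \<Longrightarrow> [2..<d + 1] @ [1] \<in> perms d"
  by (auto simp: perms_def)

lemma lab_ksimp_corner:
  assumes d: "d \<ge> 1" and M: "M \<ge> 0"
  shows "lab d M (kvert (corner d M) ([2..<d + 1] @ [1]) (d - 1)) = None"
    and "lab d M ` ksimp d (corner d M) ([2..<d + 1] @ [1]) = insert None (Some ` {1..d})"
proof -
  define p where "p = [2..<d + 1] @ [1]"
  define v where "v = kvert (corner d M) p"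
  have take_p: "set (take k p) = (if k = d then {1..d} else {2..<k + 2})" if "k \<le> d" for k
  proof (cases "k = d")
    case True
    then show ?thesis
      using d by (auto simp: p_def)
  next
    case False
    then have "take k p = [2..<2 + k]"
      using that by (simp add: p_def take_upt del: upt_Suc)
    then show ?thesis
      using False by auto
  qed
  have sum_corner: "(\<Sum>j = 1..d. corner d M j) = M - int (d - 1)"
  proof -
    have "{1..d} = insert 1 {2..d}"
      using d by auto
    then show ?thesis
      by (simp add: corner_def)
  qed
  have sum_v: "(\<Sum>j = 1..d. v k j) = M - int (d - 1) + int k" if "k \<le> d" for k
    using sum_kvert[OF corner_perm[OF d] that] sum_corner by (simp add: v_def p_def)
  have side_0: "nonneg_side d M (v k) 0 \<longleftrightarrow> k \<noteq> d" if "k \<le> d" for k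
    using sum_v[OF that] that d by (auto simp: nonneg_side_def)
  have side: "nonneg_side d M (v k) i \<longleftrightarrow> i \<le> k + 1" if "k \<le> d" "i \<in> {1..d}" for k i
  proof (cases "i = 1")
    case False
    then show ?thesis
      using that take_p[OF that(1)] by (auto simp: nonneg_side_def v_def kvert_def corner_def)
  qed (use M in \<open>auto simp: nonneg_side_def v_def kvert_def corner_def\<close>)
  have lab_inner: "lab d M (v (d - 1)) = None"
    unfolding lab_None_iff
  proof (intro allI impI)
    fix i assume "i \<le> d"
    then show "nonneg_side d M (v (d - 1)) i"
      using side_0[of "d - 1"] side[of "d - 1" i] d by (cases "i = 0") auto
  qed
  have lab_last: "lab d M (v d) = Some d"
    using d side_0[of d] side[of d] by (intro lab_eqI) (auto simp: cyc_def)
  have lab_rest: "lab d M (v k) = Some (k + 1)" if "k < d - 1" for k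
    using that side_0[of k] side[of k] by (intro lab_eqI) (auto simp: cyc_def)
  have "{..d} = {..<d - 1} \<union> {d - 1, d}"
    using d by auto
  then have "lab d M ` v ` {..d} = (\<lambda>k. lab d M (v k)) ` {..<d - 1} \<union> {None, Some d}"
    using lab_inner lab_last by (simp only: image_Un image_image) auto
  also have "(\<lambda>k. lab d M (v k)) ` {..<d - 1} = Some ` Suc ` {..<d - 1}"
    by (auto simp: image_image lab_rest intro!: image_cong)
  also have "Some ` Suc ` {..<d - 1} \<union> {None, Some d} = insert None (Some ` {1..d})"
  proof -
    have "insert d (Suc ` {..<d - 1}) = {1..d}"
      using d by (auto simp: image_iff) (metis Suc_pred diff_less_mono le_neq_implies_less lessThan_iff less_eq_Suc_le)
    then show ?thesis
      by (metis Un_insert_right image_insert insert_commute sup_bot_right)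
  qed
  finally show "lab d M ` ksimp d (corner d M) ([2..<d + 1] @ [1]) = insert None (Some ` {1..d})"
    by (simp add: ksimp_def v_def p_def)
  show "lab d M (kvert (corner d M) ([2..<d + 1] @ [1]) (d - 1)) = None"
    using lab_inner by (simp add: v_def p_def)
qed

text \<open>Coordinates only grow along the path. After the vertex labelled \<open>None\<close> only
  wall 0 can be violated, so there is room for just the vertex with label \<open>d\<close>. Before
  it, the labels increase strictly within \<open>1..d - 1\<close> and are thereby forced, and the
  path can be read off from them.\<close>

lemma lab_ksimp_unique:
  assumes d: "d \<ge> 1" and M: "M \<ge> 0" and x: "x \<in> lattice d" and p: "p \<in> perms d"
    and labels: "lab d M ` ksimp d x p = insert None (Some ` {1..d})"
  shows "x = corner d M" "p = [2..<d + 1] @ [1]"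
proof -
  define v where "v = kvert x p"
  define s where "s = (\<Sum>j = 1..d. x j)"
  have len: "length p = d"
    using p by (rule length_perms)
  have mono: "v j i \<le> v k i" if "j \<le> k" for i j k
    using set_take_subset_set_take[OF that, of p] by (auto simp: v_def kvert_def)
  have sum_v: "(\<Sum>j = 1..d. v k j) = s + int k" if "k \<le> d" for k
    unfolding v_def s_def by (rule sum_kvert[OF p that])
  have labels_v: "(\<lambda>k. lab d M (v k)) ` {..d} = insert None (Some ` {1..d})"
    using labels by (simp add: ksimp_def v_def image_image)
  have "card (insert None (Some ` {1..d})) = card {..d}"
    by (simp add: card_image)
  then have inj: "inj_on (\<lambda>k. lab d M (v k)) {..d}"
    using labels_v by (intro eq_card_imp_inj_on) auto
  have side_0: "nonneg_side d M (v k) 0 \<longleftrightarrow> s + int k \<le> M" if "k \<le> d" for k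
    using sum_v[OF that] by (simp add: nonneg_side_def)
  obtain a where a: "a \<le> d" "lab d M (v a) = None"
    using labels_v by (metis (no_types, lifting) atMost_iff imageE insertI1)
  obtain b where b: "b \<le> d" "lab d M (v b) = Some d"
    using labels_v d by (metis (no_types, lifting) atLeastAtMost_iff atMost_iff imageE imageI insertCI le_refl)
  have "\<not> nonneg_side d M (v b) 0"
    using lab_Some(3)[OF M b(2)] by (simp add: cyc_def)
  moreover have "nonneg_side d M (v a) 0"
    using a(2) unfolding lab_None_iff by blast
  ultimately have "a < b" and sum_a: "s + int a \<le> M" and sum_b: "M < s + int b"
    using a b side_0 by auto
  have after: "k = b" if k: "a < k" "k \<le> d" for k
  proof -
    have pos: "nonneg_side d M (v k) i" if i: "i \<in> {1..d}" for i
    proof -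
      have "nonneg_side d M (v a) i"
        using a(2) i unfolding lab_None_iff by auto
      then show ?thesis
        using mono[of a k i] k i by (auto simp: nonneg_side_def)
    qed
    have "lab d M (v k) \<noteq> None"
      using inj_onD[OF inj, of k a] a k by auto
    then obtain i where i: "lab d M (v k) = Some i"
      by auto
    have "i = d"
    proof (rule ccontr)
      assume "i \<noteq> d"
      then have "cyc d i \<in> {1..d}"
        using lab_Some(1)[OF M i] by (auto simp: cyc_def)
      then show False
        using pos lab_Some(3)[OF M i] by blast
    qed
    then show "k = b"
      using inj_onD[OF inj, of k b] b i k by auto
  qed
  have "b = d"
    using after[of d] \<open>a < b\<close> b by auto
  moreover have "Suc a = b"
    using after[of "Suc a"] \<open>a < b\<close> b by auto
  ultimately have a_eq: "a = d - 1" and b_eq: "b = d"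
    by auto
  have s: "s = M - int (d - 1)"
    using sum_a sum_b a_eq b_eq d by (simp add: of_nat_diff)
  have "\<exists>l. lab d M (v k) = Some l \<and> l \<in> {1..d - 1}" if k: "k < d - 1" for k
  proof -
    have "lab d M (v k) \<in> insert None (Some ` {1..d})"
      using labels_v k by (metis (no_types, lifting) atMost_iff diff_le_self imageI le_trans nat_less_le)
    moreover have "lab d M (v k) \<noteq> None" "lab d M (v k) \<noteq> Some d"
      using inj_onD[OF inj, of k a] inj_onD[OF inj, of k b] a b a_eq b_eq k by auto
    ultimately show ?thesis
      by force
  qed
  then obtain l where l: "\<And>k. k < d - 1 \<Longrightarrow> lab d M (v k) = Some (l k)"
    and l_range: "\<And>k. k < d - 1 \<Longrightarrow> l k \<in> {1..d - 1}"
    by metis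
  have pos: "nonneg_side d M (v k) i" if k: "k < d - 1" and "i \<le> l k" for k i
    using that(2)
  proof (induction i)
    case 0
    then show ?case
      using side_0[of k] k s by simp
  next
    case (Suc i)
    then show ?case
      using lab_Some(4)[OF M l[OF k], of i] l_range[OF k] by (auto simp: cyc_def split: if_splits)
  qed
  have neg: "\<not> nonneg_side d M (v k) (Suc (l k))" if k: "k < d - 1" for k
    using lab_Some(3)[OF M l[OF k]] l_range[OF k] d by (auto simp: cyc_def split: if_splits)
  have l_mono: "l j < l k" if jk: "j < k" "k < d - 1" for j k
  proof -
    have "l j \<noteq> l k"
    proof
      assume eq: "l j = l k"
      have "j \<in> {..d}" "k \<in> {..d}" "lab d M (v j) = lab d M (v k)"
        using jk l[of j] l[of k] eq by auto
      then show False
        using inj_onD[OF inj, of j k] jk by simp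
    qed
    \<comment> \<open>At \<open>v k\<close> the coordinates up to \<open>l k\<close> are nonnegative
      and the next one is negative. A larger label earlier on would make that next coordinate
      nonnegative too soon.\<close>
    moreover have "\<not> l k < l j"
    proof
      assume "l k < l j"
      then have "nonneg_side d M (v j) (Suc (l k))"
        using pos[of j "Suc (l k)"] jk by auto
      then have "nonneg_side d M (v k) (Suc (l k))"
        using mono[of j k "Suc (l k)"] jk by (simp add: nonneg_side_def)
      then show False
        using neg[OF jk(2)] by simp
    qed
    ultimately show ?thesis
      by simp
  qed
  have l_add: "l k + m \<le> l (k + m)" if "k + m < d - 1" for k m
    using that
  proof (induction m)
    case (Suc m)
    then show ?case
      using l_mono[of "k + m" "k + Suc m"] by simp
  qed simp
  have l_eq: "l k = k + 1" if k: "k < d - 1" for k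
  proof -
    have "l 0 + k \<le> l k" "l k + (d - 2 - k) \<le> l (d - 2)"
      using l_add[of 0 k] l_add[of k "d - 2 - k"] k by auto
    moreover have "1 \<le> l 0" "l (d - 2) \<le> d - 1"
      using l_range[of 0] l_range[of "d - 2"] k by auto
    ultimately show ?thesis
      using k by linarith
  qed
  \<comment> \<open>Coordinate \<open>k + 2\<close> changes from negative to nonnegative in this one
    step, so it is the one raised, and its initial value is -1.\<close>
  have step: "p ! k = k + 2 \<and> x (k + 2) = - 1" if k: "k < d - 1" for k
  proof -
    have "\<not> nonneg_side d M (v k) (k + 2)"
      using neg[OF k] l_eq[OF k] by simp
    moreover have "nonneg_side d M (v (Suc k)) (k + 2)"
    proof (cases "Suc k < d - 1")
      case True
      then show ?thesis
        using pos[of "Suc k" "k + 2"] l_eq[of "Suc k"] by simp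
    next
      case False
      then have "Suc k = a"
        using k a_eq by simp
      then show ?thesis
        using a(2) k unfolding lab_None_iff by simp
    qed
    moreover have "take (Suc k) p = take k p @ [p ! k]"
      using k len by (intro take_Suc_conv_app_nth) simp
    ultimately show ?thesis
      by (auto simp: nonneg_side_def v_def kvert_def of_bool_def split: if_splits)
  qed
  have last: "p ! (d - 1) = 1"
  proof -
    have "p ! (d - 1) \<in> {1..d}"
      using p len d nth_mem[of "d - 1" p] by (auto simp: perms_def)
    moreover have "\<not> 2 \<le> p ! (d - 1)"
    proof
      assume "2 \<le> p ! (d - 1)"
      then obtain k where k: "p ! (d - 1) = k + 2"
        by (metis le_add_diff_inverse2)
      then have "k < d - 1"
        using \<open>p ! (d - 1) \<in> {1..d}\<close> by auto
      moreover from this have "k < d"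
        by linarith
      ultimately show False
        using p len d k step[of k] nth_eq_iff_index_eq[of p "d - 1" k] by (auto simp: perms_def)
    qed
    ultimately show ?thesis
      by auto
  qed
  show p_eq: "p = [2..<d + 1] @ [1]"
  proof (rule nth_equalityI)
    fix k assume "k < length p"
    then consider "k < d - 1" | "k = d - 1"
      using len by linarith
    then show "p ! k = ([2..<d + 1] @ [1]) ! k"
      using step[of k] last by cases (auto simp: nth_append simp del: upt_Suc)
  qed (use len d in \<open>simp del: upt_Suc\<close>)
  have x_rest: "x i = - 1" if i: "i \<in> {2..d}" for i
  proof -
    obtain k where k: "i = k + 2"
      using i le_Suc_ex[of 2 i] by (auto simp: add.commute)
    then have "k < d - 1"
      using i by auto
    then show ?thesis
      using step k by simp
  qed
  have "{1..d} = insert 1 {2..d}"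
    using d by auto
  then have "s = x 1 - int (d - 1)"
    unfolding s_def by (simp add: x_rest)
  then have "x 1 = M"
    using s by simp
  then show "x = corner d M"
    using x x_rest by (auto simp: fun_eq_iff corner_def lattice_def)
qed

lemma no_contraction_of_labels:
  assumes d: "d \<ge> 1" and M: "M \<ge> 0" and B: "finite B"
    and inside: "\<And>v. v \<in> lattice d \<Longrightarrow> lab d M v = None \<Longrightarrow> v \<in> B"
    and g: "\<And>z. z \<in> kflags d \<Longrightarrow> kfacet d z \<inter> B = {} \<Longrightarrow> g (kfacet d z) = 0"
    and labels: "\<And>x p. x \<in> lattice d \<Longrightarrow> p \<in> perms d \<Longrightarrow>
      cobd g (ksimp d x p) = of_bool (lab d M ` ksimp d x p = insert None (Some ` {1..d}))"
  shows False
proof -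
  define W where "W = {(x, p). x \<in> lattice d \<and> p \<in> perms d \<and> ksimp d x p \<inter> B \<noteq> {}}"
  define c where "c = (corner d M, [2..<d + 1] @ [1 :: nat])"
  have W: "finite W"
    by (rule finite_subset[OF _ finite_ksimps_meeting[OF B, of d]]) (auto simp: W_def)
  have c: "c \<in> W"
  proof -
    have "kvert (corner d M) ([2..<d + 1] @ [1]) (d - 1) \<in> ksimp d (corner d M) ([2..<d + 1] @ [1]) \<inter> B"
      using inside[OF kvert_lattice[OF corner_lattice[OF d] corner_perm[OF d]] lab_ksimp_corner(1)[OF d M]]
      by (auto simp: ksimp_def)
    then show ?thesis
      unfolding W_def c_def using corner_lattice[OF d] corner_perm[OF d] by blast
  qed
  have "0 = (\<Sum>(x, p)\<in>W. cobd g (ksimp d x p))"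
    using sum_cobd_ksimp_eq_0[where g = g, OF d B g] by (simp add: W_def)
  also have "\<dots> = (\<Sum>w\<in>W. of_bool (w = c))"
  proof (rule sum.cong)
    fix w assume "w \<in> W"
    then obtain x p where w: "w = (x, p)" "x \<in> lattice d" "p \<in> perms d"
      by (auto simp: W_def)
    have "lab d M ` ksimp d x p = insert None (Some ` {1..d}) \<longleftrightarrow> w = c"
    proof
      assume "lab d M ` ksimp d x p = insert None (Some ` {1..d})"
      from lab_ksimp_unique[OF d M w(2,3) this] show "w = c"
        by (simp only: w(1) c_def)
    next
      assume "w = c"
      then have "x = corner d M" "p = [2..<d + 1] @ [1]"
        unfolding w(1) c_def prod.inject by (rule conjunct1, rule conjunct2)
      then show "lab d M ` ksimp d x p = insert None (Some ` {1..d})"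
        using lab_ksimp_corner(2)[OF d M] by (simp only:)
    qed
    then show "(case w of (x, p) \<Rightarrow> cobd g (ksimp d x p)) = of_bool (w = c)"
      unfolding w(1) prod.case labels[OF w(2,3)] by (simp only:)
  qed simp
  also have "\<dots> = 1"
    using W c by (simp add: of_bool_def)
  finally show False
    by simp
qed

section \<open>Hyperplane arrangements\<close>

lemma inj_on_lattice: "inj_on (\<lambda>v. map v [1..<d + 1]) (lattice d)"
proof (rule inj_onI)
  fix v w assume vw: "v \<in> lattice d" "w \<in> lattice d" "map v [1..<d + 1] = map w [1..<d + 1]"
  then have "v i = w i" if "i \<in> {1..d}" for i
    using that by (auto simp: map_eq_conv simp del: upt_Suc)
  moreover have "v i = w i" if "i \<notin> {1..d}" for i
    using vw(1,2) that by (simp add: lattice_def)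
  ultimately show "v = w"
    by blast
qed

lemma countable_lattice: "countable (lattice d)"
  by (rule countable_image_inj_on[OF _ inj_on_lattice]) (rule countableI_type)

lemma finite_lattice_box: "finite {v \<in> lattice d. \<forall>i\<in>{1..d}. \<bar>v i\<bar> \<le> r}"
proof (rule finite_imageD)
  show "inj_on (\<lambda>v. map v [1..<d + 1]) {v \<in> lattice d. \<forall>i\<in>{1..d}. \<bar>v i\<bar> \<le> r}"
    by (rule inj_on_subset[OF inj_on_lattice]) auto
  show "finite ((\<lambda>v. map v [1..<d + 1]) ` {v \<in> lattice d. \<forall>i\<in>{1..d}. \<bar>v i\<bar> \<le> r})"
  proof (rule finite_subset[of _ "{l. set l \<subseteq> {- r..r} \<and> length l = d}"])
    have "- r \<le> v i \<and> v i \<le> r" if "\<forall>i\<in>{1..d}. \<bar>v i\<bar> \<le> r" "i \<in> {1..d}" for v :: "nat \<Rightarrow> int" and i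
      using that by (auto simp: abs_le_iff minus_le_iff)
    then show "(\<lambda>v. map v [1..<d + 1]) ` {v \<in> lattice d. \<forall>i\<in>{1..d}. \<bar>v i\<bar> \<le> r} \<subseteq>
        {l. set l \<subseteq> {- r..r} \<and> length l = d}"
      by (auto simp del: upt_Suc)
  qed (simp add: finite_lists_length_eq)
qed

locale arrangement =
  fixes H :: "(real ^ 'n) set set" and a :: "(real ^ 'n) set \<Rightarrow> real ^ 'n" and b :: "(real ^ 'n) set \<Rightarrow> real"
  assumes finite_H: "finite H"
    and normal: "h \<in> H \<Longrightarrow> a h \<noteq> 0"
    and hyperplane_eq: "h \<in> H \<Longrightarrow> h = {x. a h \<bullet> x = b h}"
    and meet: "S \<subseteq> H \<Longrightarrow> card S = CARD('n) \<Longrightarrow> \<Inter>S \<noteq> {}"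
    and no_meet: "S \<subseteq> H \<Longrightarrow> card S = CARD('n) + 1 \<Longrightarrow> \<Inter>S = {}"
begin

definition f :: "(real ^ 'n) set \<Rightarrow> real ^ 'n \<Rightarrow> real" where
  "f h c = a h \<bullet> c - b h"

lemma mem_iff: "h \<in> H \<Longrightarrow> c \<in> h \<longleftrightarrow> f h c = 0"
  using hyperplane_eq[of h] by (auto simp: f_def)

lemma finite_sub: "S \<subseteq> H \<Longrightarrow> finite S"
  using finite_H finite_subset by blast

lemma sum_f: "(\<Sum>h\<in>S. u h * f h c) = (\<Sum>h\<in>S. u h *\<^sub>R a h) \<bullet> c - (\<Sum>h\<in>S. u h * b h)"
  by (simp add: f_def algebra_simps sum_subtractf inner_sum_left)

text \<open>Evaluated at a common point of the hyperplanes other than \<open>j\<close>, the relation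
  retains only the term of \<open>j\<close>. Were its coefficient nonzero, that point would lie on
  \<open>j\<close> as well.\<close>

lemma dependency_offset_eq_0:
  assumes S: "S \<subseteq> H" "card S = CARD('n) + 1"
    and u: "(\<Sum>h\<in>S. u h *\<^sub>R a h) = 0" "(\<Sum>h\<in>S. u h * b h) = 0" and j: "j \<in> S"
  shows "u j = 0"
proof (rule ccontr)
  assume uj: "u j \<noteq> 0"
  have fin: "finite S"
    using S by (simp add: finite_sub)
  have "\<Inter>(S - {j}) \<noteq> {}"
    using S j by (intro meet) auto
  then obtain x where x: "x \<in> h" if "h \<in> S - {j}" for h
    by auto
  then have "f h x = 0" if "h \<in> S - {j}" for h
    using mem_iff[of h x] S that by auto
  then have "(\<Sum>h\<in>S. u h * f h x) = u j * f j x"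
    using fin j by (subst sum.remove[OF fin j]) auto
  moreover have "(\<Sum>h\<in>S. u h * f h x) = 0"
    using u by (simp add: sum_f)
  ultimately have "x \<in> j"
    using uj mem_iff[of j x] S j by auto
  then have "x \<in> \<Inter>S"
    using x by auto
  then show False
    using no_meet[OF S] by auto
qed

text \<open>If the coefficient of \<open>j\<close> vanishes, every term vanishes at a common point
  of the other hyperplanes. Hence the offsets satisfy the same dependency as the normals.\<close>

lemma dependency_eq_0:
  assumes S: "S \<subseteq> H" "card S = CARD('n) + 1"
    and u: "(\<Sum>h\<in>S. u h *\<^sub>R a h) = 0" and j: "j \<in> S" "u j = 0" and k: "k \<in> S"
  shows "u k = 0"
proof (rule dependency_offset_eq_0[OF S u _ k])
  have fin: "finite S"
    using S by (simp add: finite_sub)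
  have "\<Inter>(S - {j}) \<noteq> {}"
    using S j by (intro meet) auto
  then obtain x where "x \<in> h" if "h \<in> S - {j}" for h
    by auto
  then have "f h x = 0" if "h \<in> S - {j}" for h
    using mem_iff[of h x] S that by auto
  then have "(\<Sum>h\<in>S. u h * f h x) = 0"
    using j by (intro sum.neutral) auto
  then show "(\<Sum>h\<in>S. u h * b h) = 0"
    using u by (simp add: sum_f)
qed

lemma ex_dependency:
  assumes S: "S \<subseteq> H" "card S = CARD('n) + 1"
  shows "\<exists>u. (\<Sum>h\<in>S. u h *\<^sub>R a h) = 0 \<and> (\<exists>h\<in>S. u h \<noteq> 0)"
proof (cases "inj_on a S")
  case True
  have "finite (a ` S)" "dependent (a ` S)"
    using S True finite_sub by (auto simp: card_image intro!: dependent_biggerset)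
  then obtain u where u: "\<exists>v\<in>a ` S. u v \<noteq> 0" "(\<Sum>v\<in>a ` S. u v *\<^sub>R v) = 0"
    using dependent_finite by blast
  then have "(\<Sum>h\<in>S. u (a h) *\<^sub>R a h) = 0"
    using True by (simp add: sum.reindex)
  then show ?thesis
    using u(1) by (intro exI[of _ "\<lambda>h. u (a h)"]) auto
next
  case False
  then obtain j k where jk: "j \<in> S" "k \<in> S" "j \<noteq> k" "a j = a k"
    by (auto simp: inj_on_def)
  have "(\<Sum>h\<in>S. (of_bool (h = j) - of_bool (h = k)) *\<^sub>R a h) = a j - a k"
    using finite_sub[OF S(1)] jk
    by (simp add: scaleR_left_diff_distrib sum_subtractf of_bool_def if_distrib[of "\<lambda>t. t *\<^sub>R _"] cong: if_cong)
  then show ?thesis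
    using jk by (intro exI[of _ "\<lambda>h. of_bool (h = j) - of_bool (h = k)"]) auto
qed

text \<open>With this normalisation, \<open>u h * f h c\<close> are the barycentric coordinates of \<open>c\<close> in the simplex
  bounded by \<open>S\<close>.\<close>

definition is_bary :: "(real ^ 'n) set set \<Rightarrow> ((real ^ 'n) set \<Rightarrow> real) \<Rightarrow> bool" where
  "is_bary S u \<longleftrightarrow> (\<Sum>h\<in>S. u h *\<^sub>R a h) = 0 \<and> (\<Sum>h\<in>S. u h * b h) = - 1"

definition bary :: "(real ^ 'n) set set \<Rightarrow> (real ^ 'n) set \<Rightarrow> real" where
  "bary S = (SOME u. is_bary S u)"

lemma is_bary_bary:
  assumes S: "S \<subseteq> H" "card S = CARD('n) + 1"
  shows "is_bary S (bary S)"
  unfolding bary_def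
proof (rule someI_ex[of "is_bary S"])
  obtain u h where u: "(\<Sum>h\<in>S. u h *\<^sub>R a h) = 0" "h \<in> S" "u h \<noteq> 0"
    using ex_dependency[OF S] by auto
  define t where "t = (\<Sum>h\<in>S. u h * b h)"
  have t: "t \<noteq> 0"
    using dependency_offset_eq_0[OF S u(1) _ u(2)] u(3) by (auto simp: t_def)
  have "(\<Sum>h\<in>S. (- u h / t) *\<^sub>R a h) = (- 1 / t) *\<^sub>R (\<Sum>h\<in>S. u h *\<^sub>R a h)"
    by (simp add: scaleR_sum_right sum_negf)
  moreover have "(\<Sum>h\<in>S. (- u h / t) * b h) = - (\<Sum>h\<in>S. u h * b h) / t"
    by (simp add: sum_divide_distrib sum_negf)
  ultimately have "is_bary S (\<lambda>h. - u h / t)"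
    using u t by (simp add: is_bary_def t_def[symmetric])
  then show "\<exists>u. is_bary S u"
    by blast
qed

context
  fixes S assumes S: "S \<subseteq> H" "card S = CARD('n) + 1"
begin

lemma sum_bary: "(\<Sum>h\<in>S. bary S h * f h c) = 1"
  using is_bary_bary[OF S] by (simp add: is_bary_def sum_f)

lemma bary_nonzero:
  assumes "h \<in> S"
  shows "bary S h \<noteq> 0"
proof
  assume "bary S h = 0"
  then have "bary S k = 0" if "k \<in> S" for k
    using dependency_eq_0[OF S _ assms] is_bary_bary[OF S] that by (simp add: is_bary_def)
  then show False
    using sum_bary[of 0] by simp
qed

text \<open>The dependencies form a line: subtracting the multiple of \<open>bary S\<close> with the
  same offset leaves a dependency with offset 0.\<close>

lemma dependency_proportional:
  assumes u: "(\<Sum>h\<in>S. u h *\<^sub>R a h) = 0" and h: "h \<in> S"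
  shows "u h = - (\<Sum>h\<in>S. u h * b h) * bary S h"
proof -
  define t where "t = - (\<Sum>h\<in>S. u h * b h)"
  have "u h - t * bary S h = 0"
  proof (rule dependency_offset_eq_0[OF S _ _ h, of "\<lambda>h. u h - t * bary S h"])
    have "(\<Sum>h\<in>S. (u h - t * bary S h) *\<^sub>R a h) = (\<Sum>h\<in>S. u h *\<^sub>R a h) - t *\<^sub>R (\<Sum>h\<in>S. bary S h *\<^sub>R a h)"
      by (simp add: scaleR_left_diff_distrib sum_subtractf scaleR_sum_right)
    then show "(\<Sum>h\<in>S. (u h - t * bary S h) *\<^sub>R a h) = 0"
      using u is_bary_bary[OF S] by (simp add: is_bary_def)
    have "(\<Sum>h\<in>S. (u h - t * bary S h) * b h) = (\<Sum>h\<in>S. u h * b h) - t * (\<Sum>h\<in>S. bary S h * b h)"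
      by (simp add: algebra_simps sum_subtractf sum_distrib_left)
    then show "(\<Sum>h\<in>S. (u h - t * bary S h) * b h) = 0"
      using is_bary_bary[OF S] by (simp add: is_bary_def t_def)
  qed
  then show ?thesis
    by (simp add: t_def)
qed

lemma normals_basis:
  assumes j: "j \<in> S"
  shows "inj_on a (S - {j})" "independent (a ` (S - {j}))" "span (a ` (S - {j})) = UNIV"
proof -
  have fin: "finite S"
    using S by (simp add: finite_sub)
  have eq_0: "u k = 0" if "(\<Sum>h\<in>S - {j}. u h *\<^sub>R a h) = 0" "k \<in> S - {j}" for u k
  proof -
    have "(\<Sum>h\<in>S. (if h = j then 0 else u h) *\<^sub>R a h) = (\<Sum>h\<in>S - {j}. u h *\<^sub>R a h)"
      using fin j by (subst sum.remove[OF fin j]) (auto intro: sum.cong)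
    then have "(\<Sum>h\<in>S. (if h = j then 0 else u h) *\<^sub>R a h) = 0"
      using that by simp
    from dependency_eq_0[OF S this j _, of k] show ?thesis
      using that by auto
  qed
  show inj: "inj_on a (S - {j})"
  proof (rule inj_onI, rule ccontr)
    fix h k assume hk: "h \<in> S - {j}" "k \<in> S - {j}" "a h = a k" "h \<noteq> k"
    have "(\<Sum>l\<in>S - {j}. (of_bool (l = h) - of_bool (l = k)) *\<^sub>R a l) = a h - a k"
      using fin hk
      by (simp add: scaleR_left_diff_distrib sum_subtractf of_bool_def if_distrib[of "\<lambda>t. t *\<^sub>R _"] cong: if_cong)
    then show False
      using eq_0[of "\<lambda>l. of_bool (l = h) - of_bool (l = k)" h] hk by simp
  qed
  show ind: "independent (a ` (S - {j}))"
  proof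
    assume "dependent (a ` (S - {j}))"
    then obtain u where u: "\<exists>v\<in>a ` (S - {j}). u v \<noteq> 0" "(\<Sum>v\<in>a ` (S - {j}). u v *\<^sub>R v) = 0"
      using dependent_finite[of "a ` (S - {j})"] fin by auto
    then have "(\<Sum>h\<in>S - {j}. u (a h) *\<^sub>R a h) = 0"
      using inj by (simp add: sum.reindex)
    then show False
      using eq_0[of "\<lambda>h. u (a h)"] u(1) by auto
  qed
  have "card (a ` (S - {j})) = CARD('n)"
    using inj fin j S by (simp add: card_image)
  then show "span (a ` (S - {j})) = UNIV"
    using card_ge_dim_independent[OF _ ind, of UNIV] by auto
qed

end

text \<open>The open simplex in barycentric coordinates. Points on a hyperplane of \<open>S\<close>
  are excluded, although they are surrounded.\<close>

definition encloses :: "(real ^ 'n) set set \<Rightarrow> real ^ 'n \<Rightarrow> bool" where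
  "encloses S c \<longleftrightarrow> (\<forall>h\<in>S. 0 < bary S h * f h c)"

text \<open>The nonnegative linear dependencies between the \<open>d + 2\<close> vectors pointing from \<open>c\<close> to the hyperplanes form
  a two-dimensional cone. The simplices containing \<open>c\<close> correspond to its extreme rays, so
  there are none or two.\<close>

lemma sum_encloses_facets_eq_0:
  assumes U: "U \<subseteq> H" "card U = CARD('n) + 2" and off: "\<And>h. h \<in> U \<Longrightarrow> f h c \<noteq> 0"
  shows "(\<Sum>u\<in>U. of_bool (encloses (U - {u}) c)) = (0 :: bit)"
proof -
  have fin: "finite U"
    using U by (simp add: finite_sub)
  \<comment> \<open>Dividing by \<open>f h c\<close> orients all normals consistently towards
    \<open>c\<close>, so that enclosing facets become dependencies with positive
    coefficients.\<close>
  define dep where "dep w \<longleftrightarrow> (\<Sum>h\<in>U. (w h / f h c) *\<^sub>R a h) = 0" for w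
  have facet: "U - {j} \<subseteq> H" "card (U - {j}) = CARD('n) + 1" if "j \<in> U" for j
    using U that by auto
  have dep_facet: "(\<Sum>h\<in>U - {j}. (w h / f h c) *\<^sub>R a h) = 0" if "dep w" "j \<in> U" "w j = 0" for w j
    using that sum.remove[OF fin \<open>j \<in> U\<close>, of "\<lambda>h. (w h / f h c) *\<^sub>R a h"] by (simp add: dep_def)
  \<comment> \<open>The dependencies form a space of dimension at most two: two vanishing
    coefficients leave none.\<close>
  have dep_0: "w h = 0" if w: "dep w" "j \<in> U" "w j = 0" "k \<in> U" "w k = 0" "j \<noteq> k" and h: "h \<in> U" for w j k h
  proof (cases "h = j")
    case False
    have "w h / f h c = 0"
      using dependency_eq_0[OF facet[OF w(2)] dep_facet[OF w(1-3)], of k h] w h False by simp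
    then show ?thesis
      using off[OF h] by simp
  qed (use w in simp)
  have dep_combine: "dep (\<lambda>h. v h + r * w h)" if "dep v" "dep w" for v w r
  proof -
    have "(\<Sum>h\<in>U. ((v h + r * w h) / f h c) *\<^sub>R a h) =
        (\<Sum>h\<in>U. (v h / f h c) *\<^sub>R a h) + r *\<^sub>R (\<Sum>h\<in>U. (w h / f h c) *\<^sub>R a h)"
      by (simp add: scaleR_sum_right sum.distrib[symmetric] algebra_simps add_divide_distrib)
    then show ?thesis
      using that by (simp add: dep_def)
  qed
  have dep_scale: "dep (\<lambda>h. r * w h)" if "dep w" for r w
    using dep_combine[of "\<lambda>h. 0" w r] that by (simp add: dep_def)
  have encloses_dep: "\<exists>w. dep w \<and> w j = 0 \<and> (\<forall>h\<in>U - {j}. 0 < w h)" if j: "j \<in> U" and "encloses (U - {j}) c" for j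
  proof (intro exI conjI)
    define w where "w h = (if h = j then 0 else bary (U - {j}) h * f h c)" for h
    have "(\<Sum>h\<in>U. (w h / f h c) *\<^sub>R a h) = (\<Sum>h\<in>U - {j}. (w h / f h c) *\<^sub>R a h)"
      using fin j by (subst sum.remove[OF fin j]) (simp add: w_def)
    also have "\<dots> = (\<Sum>h\<in>U - {j}. bary (U - {j}) h *\<^sub>R a h)"
      using off by (intro sum.cong) (auto simp: w_def)
    also have "\<dots> = 0"
      using is_bary_bary[OF facet[OF j]] by (simp add: is_bary_def)
    finally show "dep w"
      by (simp add: dep_def)
    show "w j = 0" "\<forall>h\<in>U - {j}. 0 < w h"
      using that by (auto simp: w_def encloses_def)
  qed
  have dep_encloses: "encloses (U - {j}) c"
    if j: "j \<in> U" and w: "dep w" "w j = 0" and pos: "\<And>h. h \<in> U \<Longrightarrow> h \<noteq> j \<Longrightarrow> 0 < w h" for w j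
  proof -
    define t where "t = - (\<Sum>h\<in>U - {j}. w h / f h c * b h)"
    have w_eq: "w h / f h c = t * bary (U - {j}) h" if "h \<in> U - {j}" for h
      unfolding t_def by (rule dependency_proportional[OF facet[OF j] dep_facet[OF w(1) j w(2)] that])
    have "t = (\<Sum>h\<in>U - {j}. w h / f h c * f h c)"
      unfolding sum_f dep_facet[OF w(1) j w(2)] by (simp add: t_def)
    also have "\<dots> = (\<Sum>h\<in>U - {j}. w h)"
      using off by (intro sum.cong) auto
    also have "\<dots> > 0"
    proof (rule sum_pos)
      show "U - {j} \<noteq> {}"
        using facet[OF j] by force
    qed (use fin pos in auto)
    finally have t: "t > 0" .
    show ?thesis
      unfolding encloses_def
    proof
      fix h assume h: "h \<in> U - {j}"
      then have "t * (bary (U - {j}) h * f h c) = w h"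
        using w_eq[OF h] off[of h] by (simp add: field_simps)
      then show "0 < bary (U - {j}) h * f h c"
        using t pos[of h] h by (metis DiffD1 DiffD2 insertI1 zero_less_mult_pos)
    qed
  qed
  define Z where "Z = {u \<in> U. encloses (U - {u}) c}"
  have another: "\<exists>i\<in>Z. i \<noteq> j" if "j \<in> Z" for j
  proof -
    have j: "j \<in> U" "encloses (U - {j}) c"
      using that by (auto simp: Z_def)
    obtain w where w: "dep w" "w j = 0" "\<And>h. h \<in> U \<Longrightarrow> h \<noteq> j \<Longrightarrow> 0 < w h"
      using encloses_dep[OF j] by auto
    have ne: "U - {j} \<noteq> {}"
      using facet[OF j(1)] by force
    then obtain i where i: "i \<in> U" "i \<noteq> j"
      by auto
    define v0 where "v0 h = (if h = i then 0 else bary (U - {i}) h * f h c)" for h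
    have "(\<Sum>h\<in>U. (v0 h / f h c) *\<^sub>R a h) = (\<Sum>h\<in>U - {i}. bary (U - {i}) h *\<^sub>R a h)"
      using fin i off by (subst sum.remove[OF fin i(1)]) (auto simp: v0_def intro!: sum.cong)
    then have "dep v0"
      using is_bary_bary[OF facet[OF i(1)]] by (simp add: is_bary_def dep_def)
    have "v0 j \<noteq> 0"
      using bary_nonzero[OF facet[OF i(1)], of j] i j off[OF j(1)] by (simp add: v0_def)
    define v where "v h = (1 / v0 j) * v0 h" for h
    have v: "dep v" "v j = 1"
      using dep_scale[OF \<open>dep v0\<close>, of "1 / v0 j"] \<open>v0 j \<noteq> 0\<close> unfolding v_def[abs_def] by auto
    \<comment> \<open>The smallest multiple of \<open>w\<close> whose addition makes
      \<open>v\<close> nonnegative off \<open>j\<close>. The coefficient that then becomes 0 belongs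
      to the other extreme ray.\<close>
    define r where "r = Max ((\<lambda>h. - v h / w h) ` (U - {j}))"
    have "r \<in> (\<lambda>h. - v h / w h) ` (U - {j})"
      unfolding r_def using fin ne by (intro Max_in) auto
    then obtain m where m: "m \<in> U" "m \<noteq> j" "r = - v m / w m"
      by auto
    have r: "- v h / w h \<le> r" if "h \<in> U - {j}" for h
      unfolding r_def using fin that by (intro Max_ge) auto
    define q where "q h = v h + r * w h" for h
    have q: "dep q" "q j = 1" "q m = 0"
      using dep_combine[OF v(1) w(1), of r] v w(2) w(3)[OF m(1,2)] m(3) unfolding q_def[abs_def] by auto
    have "0 < q h" if h: "h \<in> U" "h \<noteq> m" for h
    proof (cases "h = j")
      case False
      have "0 \<le> q h"
        using r[of h] w(3)[of h] h False by (simp add: q_def field_simps)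
      moreover have "q h \<noteq> 0"
        using dep_0[OF q(1) m(1) q(3) h(1) _ _ j(1)] h(2) q(2) by auto
      ultimately show ?thesis
        by simp
    qed (use q in simp)
    then have "m \<in> Z"
      using dep_encloses[OF m(1) q(1,3)] m by (simp add: Z_def)
    then show ?thesis
      using m by blast
  qed
  have at_most_two: "k = i \<or> k = j" if Z: "i \<in> Z" "j \<in> Z" "k \<in> Z" "i \<noteq> j" for i j k
  proof (rule ccontr)
    assume k: "\<not> (k = i \<or> k = j)"
    have in_U: "i \<in> U" "j \<in> U" "k \<in> U"
      using Z by (auto simp: Z_def)
    obtain u where u: "dep u" "u i = 0" "\<And>h. h \<in> U \<Longrightarrow> h \<noteq> i \<Longrightarrow> 0 < u h"
      using encloses_dep[of i] Z by (auto simp: Z_def)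
    obtain v where v: "dep v" "v j = 0" "\<And>h. h \<in> U \<Longrightarrow> h \<noteq> j \<Longrightarrow> 0 < v h"
      using encloses_dep[of j] Z by (auto simp: Z_def)
    obtain w where w: "dep w" "w k = 0" "\<And>h. h \<in> U \<Longrightarrow> h \<noteq> k \<Longrightarrow> 0 < w h"
      using encloses_dep[of k] Z by (auto simp: Z_def)
    \<comment> \<open>Eliminating \<open>j\<close> from two of the three rays gives opposite signs
      at \<open>i\<close> and \<open>k\<close>. Cancelling \<open>i\<close> with the third ray only
      increases the coefficient at \<open>k\<close>, which \<open>dep_0\<close> forces to be
      0.\<close>
    define q where "q h = u h / u j - w h / w j" for h
    have "dep (\<lambda>h. (1 / u j) * u h + (- 1) * ((1 / w j) * w h))"
      by (intro dep_combine dep_scale u w)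
    then have q: "dep q"
      by (simp add: q_def[abs_def])
    have uw: "0 < u j" "0 < w j" "0 < w i" "0 < u k" "0 < v i" "0 < v k"
      using u(3)[of j] w(3)[of j] w(3)[of i] u(3)[of k] v(3)[of i] v(3)[of k] in_U Z(4) k by auto
    have q_signs: "q j = 0" "q i < 0" "0 < q k"
      using uw u(2) w(2) by (auto simp: q_def)
    define p where "p h = q h + (- q i / v i) * v h" for h
    have "dep p"
      unfolding p_def by (rule dep_combine[OF q v(1)])
    moreover have "p j = 0" "p i = 0"
      using q_signs v(2) uw by (auto simp: p_def)
    ultimately have "p k = 0"
      using dep_0[of p j i k] in_U Z(4) by auto
    moreover have "0 < (- q i / v i) * v k"
      using q_signs uw by (intro mult_pos_pos divide_pos_pos) auto
    ultimately show False
      using q_signs by (simp add: p_def)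
  qed
  have sum: "(\<Sum>u\<in>U. of_bool (encloses (U - {u}) c)) = (\<Sum>u\<in>Z. 1 :: bit)"
    using fin by (intro sum.mono_neutral_cong_right) (auto simp: Z_def)
  show ?thesis
  proof (cases "Z = {}")
    case False
    then obtain i j where ij: "i \<in> Z" "j \<in> Z" "i \<noteq> j"
      using another by blast
    then have "Z = {i, j}"
      using at_most_two[of i j] by auto
    then show ?thesis
      using sum ij by simp
  qed (use sum in simp)
qed

text \<open>Positive barycentric coordinates with sum 1 are at most 1.\<close>

lemma encloses_bounded_coordinates:
  assumes S: "S \<subseteq> H" "card S = CARD('n) + 1" and c: "encloses S c" and h: "h \<in> S"
  shows "\<bar>f h c\<bar> \<le> 1 / \<bar>bary S h\<bar>"
proof -
  have fin: "finite S"
    using S by (simp add: finite_sub)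
  have pos: "0 < bary S k * f k c" if "k \<in> S" for k
    using c that by (simp add: encloses_def)
  have "bary S h * f h c \<le> (\<Sum>k\<in>S. bary S k * f k c)"
    using fin h pos by (intro member_le_sum) (auto intro: less_imp_le)
  also have "\<dots> = 1"
    by (rule sum_bary[OF S])
  finally have "\<bar>bary S h\<bar> * \<bar>f h c\<bar> \<le> 1"
    using pos[OF h] by (simp add: abs_mult[symmetric])
  then show ?thesis
    using bary_nonzero[OF S h] by (simp add: field_simps)
qed

text \<open>The normals span the space, so bounds on the functions \<open>f h\<close> bound every
  linear functional, in particular the coordinates.\<close>

lemma bounded_if_bounded_coordinates:
  assumes S: "S \<subseteq> H" "card S = CARD('n) + 1"
    and C: "\<And>c h. c \<in> C \<Longrightarrow> h \<in> S \<Longrightarrow> \<bar>f h c\<bar> \<le> r h"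
  shows "bounded C"
proof -
  obtain j where j: "j \<in> S"
    using S by fastforce
  have "\<exists>R. \<forall>c\<in>C. \<bar>y \<bullet> c\<bar> \<le> R" for y
  proof -
    have "y \<in> span (a ` (S - {j}))"
      using normals_basis(3)[OF S j] by simp
    then show ?thesis
    proof (induction rule: span_induct_alt)
      case base
      then show ?case
        by auto
    next
      case (step r0 x y)
      obtain h where h: "h \<in> S" "x = a h"
        using step(1) by auto
      obtain R where R: "\<forall>c\<in>C. \<bar>y \<bullet> c\<bar> \<le> R"
        using step(2) by auto
      have "\<bar>(r0 *\<^sub>R x + y) \<bullet> c\<bar> \<le> \<bar>r0\<bar> * (r h + \<bar>b h\<bar>) + R" if "c \<in> C" for c
      proof -
        have "\<bar>x \<bullet> c\<bar> \<le> r h + \<bar>b h\<bar>"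
          using C[OF that h(1)] by (simp add: f_def h(2))
        then have "\<bar>r0 * (x \<bullet> c)\<bar> \<le> \<bar>r0\<bar> * (r h + \<bar>b h\<bar>)"
          by (simp add: abs_mult mult_left_mono)
        moreover have "(r0 *\<^sub>R x + y) \<bullet> c = r0 * (x \<bullet> c) + y \<bullet> c"
          by (simp add: inner_add_left)
        moreover have "\<bar>y \<bullet> c\<bar> \<le> R"
          using R that by blast
        ultimately show ?thesis
          by linarith
      qed
      then show ?case
        by blast
    qed
  qed
  then obtain R where R: "\<And>y c. c \<in> C \<Longrightarrow> \<bar>y \<bullet> c\<bar> \<le> R y"
    by metis
  have "norm c \<le> (\<Sum>y\<in>Basis. R y)" if "c \<in> C" for c
  proof -
    have "norm c \<le> (\<Sum>y\<in>Basis. \<bar>c \<bullet> y\<bar>)"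
      by (rule norm_le_l1)
    also have "\<dots> \<le> (\<Sum>y\<in>Basis. R y)"
      using R[OF that] by (intro sum_mono) (simp add: inner_commute)
    finally show ?thesis .
  qed
  then show ?thesis
    by (auto simp: bounded_iff)
qed

lemma bounded_enclosed: "bounded {c. \<exists>S\<subseteq>H. card S = CARD('n) + 1 \<and> encloses S c}"
proof -
  have "bounded (\<Union>S\<in>{S. S \<subseteq> H \<and> card S = CARD('n) + 1}. {c. encloses S c})"
  proof (rule bounded_UN)
    show "finite {S. S \<subseteq> H \<and> card S = CARD('n) + 1}"
      using finite_H by simp
    show "\<forall>S\<in>{S. S \<subseteq> H \<and> card S = CARD('n) + 1}. bounded {c. encloses S c}"
    proof clarify
      fix S assume S: "S \<subseteq> H" "card S = CARD('n) + 1"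
      show "bounded {c. encloses S c}"
        using encloses_bounded_coordinates[OF S]
        by (intro bounded_if_bounded_coordinates[OF S, of _ "\<lambda>h. 1 / \<bar>bary S h\<bar>"]) simp
    qed
  qed
  then show ?thesis
    by (rule bounded_subset) auto
qed

text \<open>On a connected set that avoids the hyperplanes no \<open>f h\<close> changes sign, so
  the whole component of \<open>c\<close> is enclosed and hence bounded.\<close>

lemma encloses_imp_surrounds:
  assumes S: "S \<subseteq> H" "card S = CARD('n) + 1" and c: "encloses S c"
  shows "surrounds S c"
proof -
  define C where "C = connected_component_set (- \<Union>S) c"
  have off: "f h c \<noteq> 0" if "h \<in> S" for h
    using c that by (force simp: encloses_def)
  then have c_off: "c \<in> - \<Union>S"
    using mem_iff S(1) by blast
  then have c_C: "c \<in> C" "C \<in> components (- \<Union>S)"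
    by (auto simp: C_def components_def)
  have C_off: "f h x \<noteq> 0" if "x \<in> C" "h \<in> S" for x h
  proof -
    have "x \<in> - \<Union>S"
      using connected_component_subset[of "- \<Union>S" c] that(1) unfolding C_def by blast
    then show ?thesis
      using that(2) mem_iff[of h x] S(1) by blast
  qed
  have "encloses S x" if x: "x \<in> C" for x
    unfolding encloses_def
  proof (rule ballI, rule ccontr)
    fix h assume h: "h \<in> S" and "\<not> 0 < bary S h * f h x"
    moreover have "0 < bary S h * f h c"
      using c h by (simp add: encloses_def)
    ultimately have "f h c * f h x \<le> 0"
      by (smt (verit) mult_neg_neg mult_pos_neg mult_pos_pos zero_less_mult_iff mult_nonneg_nonpos mult_nonpos_nonneg)
    then have "a h \<bullet> c \<le> b h \<and> b h \<le> a h \<bullet> x \<or> a h \<bullet> x \<le> b h \<and> b h \<le> a h \<bullet> c"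
      by (auto simp: f_def mult_le_0_iff)
    moreover have conn: "connected C"
      by (simp add: C_def)
    ultimately have "\<exists>z\<in>C. a h \<bullet> z = b h"
      using connected_ivt_hyperplane[OF conn c_C(1) x] connected_ivt_hyperplane[OF conn x c_C(1)] by blast
    then show False
      using C_off[OF _ h] by (auto simp: f_def)
  qed
  then have "bounded C"
    using S by (intro bounded_subset[OF bounded_enclosed]) blast
  then show ?thesis
    using c_C by (auto simp: surrounds_def)
qed

text \<open>For \<open>d + 1\<close> hyperplanes the combination in \<open>sum_bary\<close> equals
  1, so their \<open>f h c\<close> cannot all be tiny. The radius is uniform since only finitely
  many coefficients occur. This is where the bound \<open>d\<close> on the number of separators
  comes from.\<close>

lemma few_near:
  obtains r where "r > 0" "\<And>c. card {h \<in> H. \<bar>f h c\<bar> < r} \<le> CARD('n)"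
proof -
  define \<S> where "\<S> = {S. S \<subseteq> H \<and> card S = CARD('n) + 1}"
  define T where "T = (\<Sum>S\<in>\<S>. \<Sum>h\<in>S. \<bar>bary S h\<bar>)"
  have fin: "finite \<S>"
    using finite_H by (simp add: \<S>_def)
  have T: "T \<ge> 0"
    unfolding T_def by (intro sum_nonneg) auto
  define r where "r = 1 / (1 + T)"
  have r: "r > 0" "r * T < 1"
    using T by (auto simp: r_def field_simps)
  show thesis
  proof (rule that[OF r(1)], rule ccontr)
    fix c assume "\<not> card {h \<in> H. \<bar>f h c\<bar> < r} \<le> CARD('n)"
    then have "CARD('n) + 1 \<le> card {h \<in> H. \<bar>f h c\<bar> < r}"
      by simp
    then obtain S where S: "S \<subseteq> {h \<in> H. \<bar>f h c\<bar> < r}" "card S = CARD('n) + 1"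
      by (rule obtain_subset_with_card_n) blast
    then have S_H: "S \<subseteq> H" "S \<in> \<S>"
      by (auto simp: \<S>_def)
    have "1 = (\<Sum>h\<in>S. bary S h * f h c)"
      by (rule sum_bary[OF S_H(1) S(2), symmetric])
    also have "\<dots> \<le> (\<Sum>h\<in>S. \<bar>bary S h\<bar> * r)"
    proof (rule sum_mono)
      fix h assume "h \<in> S"
      have "bary S h * f h c \<le> \<bar>bary S h\<bar> * \<bar>f h c\<bar>"
        by (metis abs_ge_self abs_mult)
      also have "\<dots> \<le> \<bar>bary S h\<bar> * r"
        using S \<open>h \<in> S\<close> by (intro mult_left_mono) auto
      finally show "bary S h * f h c \<le> \<bar>bary S h\<bar> * r" .
    qed
    also have "\<dots> = r * (\<Sum>h\<in>S. \<bar>bary S h\<bar>)"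
      by (simp add: sum_distrib_left mult.commute)
    also have "\<dots> \<le> r * T"
      unfolding T_def using fin S_H r(1) by (intro mult_left_mono member_le_sum) (auto intro: sum_nonneg)
    finally show False
      using r(2) by simp
  qed
qed

lemma ex_dual_basis:
  assumes S: "S \<subseteq> H" "card S = CARD('n) + 1" and j: "j \<in> S"
  obtains e where "\<And>h k. h \<in> S - {j} \<Longrightarrow> k \<in> S - {j} \<Longrightarrow> bary S h * (a h \<bullet> e k) = of_bool (h = k)"
proof -
  have "\<exists>e. \<forall>h\<in>S - {j}. bary S h * (a h \<bullet> e) = of_bool (h = k)" if k: "k \<in> S - {j}" for k
  proof -
    obtain g :: "real ^ 'n \<Rightarrow> real" where g: "linear g"
      "\<forall>x\<in>a ` (S - {j}). g x = (if x = a k then 1 / bary S k else 0)"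
      using linear_independent_extend[OF normals_basis(2)[OF S j],
          of "\<lambda>x. if x = a k then 1 / bary S k else 0"] by auto
    have "bary S h * (a h \<bullet> adjoint g 1) = of_bool (h = k)" if h: "h \<in> S - {j}" for h
    proof -
      have "a h \<bullet> adjoint g 1 = g (a h)"
        using adjoint_works[OF g(1)] by simp
      moreover have "a h = a k \<longleftrightarrow> h = k"
        using inj_onD[OF normals_basis(1)[OF S j]] h k by blast
      ultimately show ?thesis
        using g(2) h bary_nonzero[OF S, of h] by auto
    qed
    then show ?thesis
      by blast
  qed
  then show thesis
    using that by metis
qed

lemma ex_grid:
  fixes d :: nat and h :: "nat \<Rightarrow> (real ^ 'n) set"
  defines "d \<equiv> CARD('n)"
  assumes h: "inj_on h {..d}" "h ` {..d} \<subseteq> H"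
  obtains M :: int and c :: "(nat \<Rightarrow> int) \<Rightarrow> real ^ 'n" where "M \<ge> 0"
    and "\<And>v k. v \<in> lattice d \<Longrightarrow> k \<in> H \<Longrightarrow> f k (c v) \<noteq> 0"
    and "\<And>v i. v \<in> lattice d \<Longrightarrow> i \<le> d \<Longrightarrow>
      0 < bary (h ` {..d}) (h i) * f (h i) (c v) \<longleftrightarrow> nonneg_side d M v i"
    and "\<And>C. bounded C \<Longrightarrow> finite {v \<in> lattice d. c v \<in> C}"
    and "\<And>x p. x \<in> lattice d \<Longrightarrow> p \<in> perms d \<Longrightarrow>
      card {k \<in> H. \<exists>v\<in>ksimp d x p. \<exists>w\<in>ksimp d x p. 0 < f k (c v) \<and> f k (c w) < 0} \<le> d"
proof -
  define S where "S = h ` {..d}"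
  have S: "S \<subseteq> H" "card S = CARD('n) + 1"
    using h by (auto simp: S_def card_image d_def)
  have d: "d \<ge> 1"
    by (simp add: d_def Suc_leI)
  have h_S: "h i \<in> S" if "i \<le> d" for i
    using that by (simp add: S_def)
  have h_0: "h i \<noteq> h 0" if "i \<in> {1..d}" for i
    using inj_onD[OF h(1), of i 0] that by auto
  define z where "z i x = bary S (h i) * f (h i) x" for i x
  obtain e where e: "\<And>k l. k \<in> S - {h 0} \<Longrightarrow> l \<in> S - {h 0} \<Longrightarrow> bary S k * (a k \<bullet> e l) = of_bool (k = l)"
    using ex_dual_basis[OF S h_S[of 0]] by blast
  have dual: "bary S (h i) * (a (h i) \<bullet> e (h j)) = of_bool (i = j)" if "i \<in> {1..d}" "j \<in> {1..d}" for i j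
    using e[of "h i" "h j"] h_S h_0 that inj_on_eq_iff[OF h(1), of i j] by auto
  define shift where "shift v = (\<Sum>i = 1..d. v i *\<^sub>R e (h i))" for v :: "nat \<Rightarrow> real"
  have z_shift: "z i (x + shift v) = z i x + v i" if i: "i \<in> {1..d}" for i x v
  proof -
    have "bary S (h i) * (a (h i) \<bullet> shift v) = (\<Sum>j = 1..d. v j * (bary S (h i) * (a (h i) \<bullet> e (h j))))"
      by (simp add: shift_def inner_sum_right sum_distrib_left mult_ac)
    also have "\<dots> = (\<Sum>j = 1..d. if i = j then v j else 0)"
      using dual[OF i] by (intro sum.cong) auto
    also have "\<dots> = v i"
      using i by simp
    finally show ?thesis
      by (simp add: z_def f_def inner_add_right algebra_simps)
  qed
  have sum_z: "z 0 x + (\<Sum>i = 1..d. z i x) = 1" for x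
  proof -
    have "1 = (\<Sum>k\<in>S. bary S k * f k x)"
      by (rule sum_bary[OF S, symmetric])
    also have "\<dots> = (\<Sum>i\<le>d. z i x)"
      unfolding S_def z_def using sum.reindex[OF h(1)] by simp
    also have "\<dots> = z 0 x + (\<Sum>i = 1..d. z i x)"
      by (simp add: sum.atMost_shift sum.shift_bounds_Suc_ivl atLeast0AtMost[symmetric] sum.atLeast_Suc_atMost)
    finally show ?thesis
      by simp
  qed
  obtain r where r: "r > 0" and near: "\<And>x. card {k \<in> H. \<bar>f k x\<bar> < r} \<le> d"
    using few_near unfolding d_def by blast
  define E where "E = (\<Sum>i = 1..d. norm (e (h i)))"
  define A where "A = (\<Sum>k\<in>H. norm (a k))"
  have EA: "E \<ge> 0" "A \<ge> 0"
    by (auto simp: E_def A_def intro: sum_nonneg)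
  \<comment> \<open>The first bound makes the origin of the grid lie on the good side of wall 0, so
    that \<open>M \<ge> 0\<close>; the second keeps each \<open>f k\<close> from varying by
    \<open>r\<close> or more within a grid simplex.\<close>
  define \<epsilon> where "\<epsilon> = min (1 / real d) (r / (1 + A * E))"
  have \<epsilon>: "\<epsilon> > 0" "real d * \<epsilon> \<le> 1" "\<epsilon> * (A * E) < r"
  proof -
    have pos: "1 + A * E > 0"
      using EA by (simp add: add_pos_nonneg)
    show "\<epsilon> > 0"
      using r d pos by (simp add: \<epsilon>_def)
    have "real d * \<epsilon> \<le> real d * (1 / real d)"
      by (intro mult_left_mono) (auto simp: \<epsilon>_def)
    then show "real d * \<epsilon> \<le> 1"
      using d by simp
    have "\<epsilon> * (A * E) \<le> r / (1 + A * E) * (A * E)"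
      using EA by (intro mult_right_mono) (auto simp: \<epsilon>_def)
    also have "\<dots> < r"
      using pos r by (simp add: field_simps)
    finally show "\<epsilon> * (A * E) < r" .
  qed
  \<comment> \<open>An offset strictly between 0 and the mesh size turns the sign of
    \<open>z i q + \<epsilon> * v i\<close> into the condition \<open>0 \<le> v i\<close>.\<close>
  define Q where "Q = {q. \<forall>i\<in>{1..d}. 0 < z i q \<and> z i q < \<epsilon>}"
  have "open Q"
  proof -
    have "Q = (\<Inter>i\<in>{1..d}. {q. 0 < z i q} \<inter> {q. z i q < \<epsilon>})"
      by (auto simp: Q_def)
    moreover have "continuous_on UNIV (z i)" for i
      unfolding z_def f_def by (intro continuous_intros)
    ultimately show ?thesis
      by (auto intro!: open_INT open_Int open_Collect_less continuous_intros)
  qed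
  moreover have "Q \<noteq> {}"
  proof -
    have "\<Inter>(S - {h 0}) \<noteq> {}"
      using S h_S[of 0] by (intro meet) auto
    then obtain p where p: "p \<in> k" if "k \<in> S - {h 0}" for k
      by auto
    have "z i p = 0" if "i \<in> {1..d}" for i
      using p[of "h i"] mem_iff[of "h i" p] that h_S[of i] h_0[of i] S(1) by (auto simp: z_def)
    then have "p + shift (\<lambda>i. \<epsilon> / 2) \<in> Q"
      using \<epsilon>(1) by (simp add: Q_def z_shift)
    then show ?thesis
      by blast
  qed
  ultimately have "\<not> negligible Q"
    by (rule open_not_negligible)
  define c0 where "c0 q v = q + shift (\<lambda>i. \<epsilon> * real_of_int (v i))" for q and v :: "nat \<Rightarrow> int"
  \<comment> \<open>The translations that put some grid point on some hyperplane form a countable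
    union of hyperplanes, whereas \<open>Q\<close> is open and nonempty.\<close>
  have "negligible (\<Union>((\<lambda>(k, v). {q. f k (c0 q v) = 0}) ` (H \<times> lattice d)))"
  proof (rule negligible_countable_Union)
    show "countable ((\<lambda>(k, v). {q. f k (c0 q v) = 0}) ` (H \<times> lattice d))"
      using countable_lattice finite_H by (intro countable_image countable_SIGMA) (auto simp: countable_finite)
    fix T assume "T \<in> (\<lambda>(k, v). {q. f k (c0 q v) = 0}) ` (H \<times> lattice d)"
    then obtain k v where T: "k \<in> H" "T = {q. f k (c0 q v) = 0}"
      by auto
    have "T = {q. a k \<bullet> q = b k - a k \<bullet> shift (\<lambda>i. \<epsilon> * real_of_int (v i))}"
      unfolding T(2) by (auto simp: f_def c0_def inner_add_right)
    then show "negligible T"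
      using negligible_hyperplane[OF disjI1, OF normal[OF T(1)]] by (simp only:)
  qed
  then have "\<not> Q \<subseteq> \<Union>((\<lambda>(k, v). {q. f k (c0 q v) = 0}) ` (H \<times> lattice d))"
    using \<open>\<not> negligible Q\<close> negligible_subset by blast
  then obtain q where q: "q \<in> Q" "\<And>k v. k \<in> H \<Longrightarrow> v \<in> lattice d \<Longrightarrow> f k (c0 q v) \<noteq> 0"
    by auto
  define c where "c = c0 q"
  define R where "R = (1 - (\<Sum>i = 1..d. z i q)) / \<epsilon>"
  \<comment> \<open>The largest integer strictly below \<open>R\<close>, also when \<open>R\<close>
    is an integer.\<close>
  define M where "M = \<lceil>R\<rceil> - 1"
  have z_c: "z i (c v) = z i q + \<epsilon> * real_of_int (v i)" if "i \<in> {1..d}" for i v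
    using z_shift[OF that] by (simp add: c_def c0_def)
  have "(\<Sum>i = 1..d. z i q) < (\<Sum>i = 1..d. \<epsilon>)"
    using q(1) d by (intro sum_strict_mono) (auto simp: Q_def)
  then have "R > 0"
    using \<epsilon> by (simp add: R_def)
  then have M: "M \<ge> 0"
    by (simp add: M_def)
  have side: "0 < z i (c v) \<longleftrightarrow> nonneg_side d M v i" if "i \<le> d" for i v
  proof (cases "i = 0")
    case True
    have "z 0 (c v) = 1 - (\<Sum>i = 1..d. z i (c v))"
      using sum_z[of "c v"] by simp
    also have "(\<Sum>i = 1..d. z i (c v)) = (\<Sum>i = 1..d. z i q) + \<epsilon> * real_of_int (\<Sum>i = 1..d. v i)"
      by (simp add: z_c sum.distrib sum_distrib_left)
    finally have z_0: "z 0 (c v) = 1 - ((\<Sum>i = 1..d. z i q) + \<epsilon> * real_of_int (\<Sum>i = 1..d. v i))" .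
    have "0 < z 0 (c v) \<longleftrightarrow> real_of_int (\<Sum>i = 1..d. v i) < R"
      unfolding z_0 R_def pos_less_divide_eq[OF \<epsilon>(1)] mult.commute[of _ \<epsilon>] by (auto simp del: of_int_sum)
    also have "\<dots> \<longleftrightarrow> (\<Sum>i = 1..d. v i) \<le> M"
      unfolding M_def less_ceiling_iff[symmetric] by linarith
    finally show ?thesis
      using True by (simp add: nonneg_side_def)
  next
    case False
    then have i: "i \<in> {1..d}"
      using that by auto
    have zq: "0 < z i q" "z i q < \<epsilon>"
      using q(1) i by (auto simp: Q_def)
    have "0 < z i q + \<epsilon> * real_of_int (v i) \<longleftrightarrow> 0 \<le> v i"
    proof
      assume "0 \<le> v i"
      then show "0 < z i q + \<epsilon> * real_of_int (v i)"
        using zq \<epsilon>(1) by (intro add_pos_nonneg) auto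
    next
      assume pos: "0 < z i q + \<epsilon> * real_of_int (v i)"
      show "0 \<le> v i"
      proof (rule ccontr)
        assume "\<not> 0 \<le> v i"
        then have "real_of_int (v i) \<le> - 1"
          by linarith
        then have "\<epsilon> * real_of_int (v i) \<le> \<epsilon> * (- 1)"
          using \<epsilon>(1) by (intro mult_left_mono) auto
        then show False
          using pos zq by simp
      qed
    qed
    then show ?thesis
      using False by (simp add: z_c[OF i] nonneg_side_def)
  qed
  have fin: "finite {v \<in> lattice d. c v \<in> C}" if C: "bounded C" for C
  proof -
    obtain K where K: "\<And>x. x \<in> C \<Longrightarrow> norm x \<le> K"
      using C by (auto simp: bounded_iff)
    define B where "B = (\<Sum>i = 1..d. \<bar>bary S (h i)\<bar> * (norm (a (h i)) * K + \<bar>b (h i)\<bar>) + \<epsilon>) / \<epsilon>"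
    have "{v \<in> lattice d. c v \<in> C} \<subseteq> {v \<in> lattice d. \<forall>i\<in>{1..d}. \<bar>v i\<bar> \<le> \<lceil>B\<rceil>}"
    proof clarify
      fix v i assume v: "v \<in> lattice d" "c v \<in> C" and i: "i \<in> {1..d}"
      have K0: "0 \<le> K"
        using K[OF v(2)] norm_ge_zero order_trans by blast
      have "\<bar>a (h i) \<bullet> c v\<bar> \<le> norm (a (h i)) * K"
        using Cauchy_Schwarz_ineq2[of "a (h i)" "c v"] mult_left_mono[OF K[OF v(2)], of "norm (a (h i))"] by simp
      then have "\<bar>f (h i) (c v)\<bar> \<le> norm (a (h i)) * K + \<bar>b (h i)\<bar>"
        unfolding f_def by linarith
      then have "\<bar>z i (c v)\<bar> \<le> \<bar>bary S (h i)\<bar> * (norm (a (h i)) * K + \<bar>b (h i)\<bar>)"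
        by (simp add: z_def abs_mult mult_left_mono)
      moreover have "\<epsilon> * \<bar>real_of_int (v i)\<bar> = \<bar>z i (c v) - z i q\<bar>"
        using \<epsilon>(1) by (simp add: z_c[OF i] abs_mult)
      moreover have "0 < z i q" "z i q < \<epsilon>"
        using q(1) i by (auto simp: Q_def)
      ultimately have "\<epsilon> * \<bar>real_of_int (v i)\<bar> \<le> \<bar>bary S (h i)\<bar> * (norm (a (h i)) * K + \<bar>b (h i)\<bar>) + \<epsilon>"
        by linarith
      also have "\<dots> \<le> (\<Sum>i = 1..d. \<bar>bary S (h i)\<bar> * (norm (a (h i)) * K + \<bar>b (h i)\<bar>) + \<epsilon>)"
        using i K0 \<epsilon>(1) by (intro member_le_sum) (auto intro!: add_nonneg_nonneg mult_nonneg_nonneg)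
      also have "\<dots> = \<epsilon> * B"
        using \<epsilon>(1) by (simp add: B_def)
      finally have "\<bar>real_of_int (v i)\<bar> \<le> B"
        using \<epsilon>(1) by simp
      then show "\<bar>v i\<bar> \<le> \<lceil>B\<rceil>"
        by linarith
    qed
    then show ?thesis
      by (rule finite_subset) (rule finite_lattice_box)
  qed
  have few: "card {k \<in> H. \<exists>v\<in>ksimp d x p. \<exists>w\<in>ksimp d x p. 0 < f k (c v) \<and> f k (c w) < 0} \<le> d"
    if x: "x \<in> lattice d" and p: "p \<in> perms d" for x p
  proof -
    have close: "\<bar>f k (c v) - f k (c x)\<bar> < r" if k: "k \<in> H" and v: "v \<in> ksimp d x p" for k v
    proof -
      obtain j where j: "v = kvert x p j"
        using v by (auto simp: ksimp_def)
      have "c v - c x = (\<Sum>i = 1..d. (\<epsilon> * of_bool (i \<in> set (take j p))) *\<^sub>R e (h i))"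
        by (simp add: c_def c0_def shift_def j kvert_def sum_subtractf[symmetric] scaleR_left_diff_distrib[symmetric]
            right_diff_distrib[symmetric])
      also have "norm \<dots> \<le> (\<Sum>i = 1..d. \<epsilon> * norm (e (h i)))"
        using \<epsilon>(1) by (intro sum_norm_le) (auto simp: of_bool_def)
      also have "\<dots> = \<epsilon> * E"
        by (simp add: E_def sum_distrib_left)
      finally have norm_le: "norm (c v - c x) \<le> \<epsilon> * E" .
      have "\<bar>f k (c v) - f k (c x)\<bar> = \<bar>a k \<bullet> (c v - c x)\<bar>"
        by (simp add: f_def inner_diff_right)
      also have "\<dots> \<le> norm (a k) * norm (c v - c x)"
        by (rule Cauchy_Schwarz_ineq2)
      also have "\<dots> \<le> A * (\<epsilon> * E)"
        using norm_le EA k finite_H unfolding A_def by (intro mult_mono member_le_sum) (auto intro: sum_nonneg)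
      also have "\<dots> < r"
        using \<epsilon>(3) by (simp add: mult_ac)
      finally show ?thesis .
    qed
    have "{k \<in> H. \<exists>v\<in>ksimp d x p. \<exists>w\<in>ksimp d x p. 0 < f k (c v) \<and> f k (c w) < 0} \<subseteq> {k \<in> H. \<bar>f k (c x)\<bar> < r}"
    proof clarify
      fix k v w assume k: "k \<in> H" and vw: "v \<in> ksimp d x p" "w \<in> ksimp d x p" "0 < f k (c v)" "f k (c w) < 0"
      show "\<bar>f k (c x)\<bar> < r"
        using close[OF k vw(1)] close[OF k vw(2)] vw(3,4) by linarith
    qed
    then have "card {k \<in> H. \<exists>v\<in>ksimp d x p. \<exists>w\<in>ksimp d x p. 0 < f k (c v) \<and> f k (c w) < 0} \<le>
        card {k \<in> H. \<bar>f k (c x)\<bar> < r}"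
      using finite_H by (intro card_mono) auto
    also have "\<dots> \<le> d"
      by (rule near)
    finally show ?thesis .
  qed
  show thesis
  proof (rule that[OF M _ _ fin few])
    show "f k (c v) \<noteq> 0" if "v \<in> lattice d" "k \<in> H" for v k
      using q(2) that by (simp add: c_def)
    show "0 < bary (h ` {..d}) (h i) * f (h i) (c v) \<longleftrightarrow> nonneg_side d M v i" if "i \<le> d" for v i
      using side[OF that] by (simp add: z_def S_def)
  qed
qed

end

section \<open>Heavily surrounded points\<close>

lemma (in arrangement) encloses_agree:
  assumes "\<And>h. h \<in> S \<Longrightarrow> f h x \<noteq> 0 \<and> f h y \<noteq> 0 \<and> (0 < f h x \<longleftrightarrow> 0 < f h y)"
  shows "encloses S x \<longleftrightarrow> encloses S y"
proof -
  have "0 < bary S h * f h x \<longleftrightarrow> 0 < bary S h * f h y" if "h \<in> S" for h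
    using assms[OF that] by (auto simp: zero_less_mult_iff)
  then show ?thesis
    by (simp add: encloses_def)
qed

lemma (in arrangement) ex_heavily_enclosed:
  assumes card_H: "CARD('n) < card H"
    and A: "A * fact CARD('n) * fact (CARD('n) + 1) * (real CARD('n) + 1)\<^sup>2 <
      2 * real CARD('n) * (real (card H) - real CARD('n)) ^ (CARD('n) + 1)"
  shows "\<exists>c. A < real (card {S. S \<subseteq> H \<and> card S = CARD('n) + 1 \<and> encloses S c})"
proof (rule ccontr)
  assume "\<not> (\<exists>c. A < real (card {S. S \<subseteq> H \<and> card S = CARD('n) + 1 \<and> encloses S c}))"
  then have few: "real (card {S. S \<subseteq> H \<and> card S = CARD('n) + 1 \<and> encloses S c}) \<le> A" for c
    by (simp add: not_less)
  define d where "d = CARD('n)"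
  have d: "d \<ge> 1"
    by (simp add: d_def Suc_leI)
  have "d + 1 \<le> card H"
    using card_H by (simp add: d_def)
  then obtain H' where H': "H' \<subseteq> H" "card H' = d + 1"
    by (rule obtain_subset_with_card_n) blast
  then obtain h where h: "bij_betw h {..d} H'"
    using finite_same_card_bij[of "{..d}" H'] finite_sub[OF H'(1)] by auto
  then have h_inj: "inj_on h {..d}" and h_img: "h ` {..d} = H'"
    by (auto simp: bij_betw_def)
  obtain M :: int and c :: "(nat \<Rightarrow> int) \<Rightarrow> real ^ 'n" where M: "M \<ge> 0"
    and off: "\<And>v k. v \<in> lattice d \<Longrightarrow> k \<in> H \<Longrightarrow> f k (c v) \<noteq> 0"
    and side: "\<And>v i. v \<in> lattice d \<Longrightarrow> i \<le> d \<Longrightarrow>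
      0 < bary H' (h i) * f (h i) (c v) \<longleftrightarrow> nonneg_side d M v i"
    and fin_bounded: "\<And>C. bounded C \<Longrightarrow> finite {v \<in> lattice d. c v \<in> C}"
    and few_crossing: "\<And>x p. x \<in> lattice d \<Longrightarrow> p \<in> perms d \<Longrightarrow>
      card {k \<in> H. \<exists>v\<in>ksimp d x p. \<exists>w\<in>ksimp d x p. 0 < f k (c v) \<and> f k (c w) < 0} \<le> d"
  proof (rule ex_grid[of h, folded d_def, unfolded h_img, OF h_inj H'(1)], goal_cases)
    case (1 M c)
    from 1(2-) show ?case
      by (rule 1(1))
  qed
  define K where "K = {\<sigma>. \<exists>x\<in>lattice d. \<exists>p\<in>perms d. \<sigma> \<subseteq> ksimp d x p}"
  define N where "N \<sigma> = {k \<in> H. \<exists>v\<in>\<sigma>. \<exists>w\<in>\<sigma>. 0 < f k (c v) \<and> f k (c w) < 0}" for \<sigma>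
  define B where "B = {v \<in> lattice d. \<exists>S\<subseteq>H. card S = CARD('n) + 1 \<and> encloses S (c v)}"
  define F where "F v S = (of_bool (v \<in> lattice d \<and> S \<subseteq> H \<and> card S = d + 1 \<and> encloses S (c v)) :: bit)" for v S
  have K_lattice: "v \<in> lattice d" if "\<sigma> \<in> K" "v \<in> \<sigma>" for \<sigma> v
    using that kvert_lattice by (auto simp: K_def ksimp_def)
  have fin_K: "finite \<sigma>" if "\<sigma> \<in> K" for \<sigma>
    using that finite_subset[OF _ finite_ksimp] unfolding K_def by blast
  have fin_B: "finite B"
    using fin_bounded[OF bounded_enclosed] by (simp add: B_def)
  interpret separation_complex H K N B d F
  proof
    show "finite H" "d \<ge> 1" "d < card H"
      using finite_H d card_H by (simp_all add: d_def)
    show "finite \<sigma>" if "\<sigma> \<in> K" for \<sigma>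
      using that by (rule fin_K)
    show "\<tau> \<in> K" if "\<sigma> \<in> K" "\<tau> \<subseteq> \<sigma>" for \<sigma> \<tau>
      using that unfolding K_def by blast
    show "N \<tau> \<subseteq> N \<sigma>" if "\<tau> \<subseteq> \<sigma>" for \<sigma> \<tau>
      using that unfolding N_def by blast
    show "N {v} = {}" for v
      by (auto simp: N_def)
    show "finite (N \<sigma>)" for \<sigma>
      using finite_H by (simp add: N_def)
    show "card (N \<sigma>) \<le> d" if \<sigma>: "\<sigma> \<in> K" for \<sigma>
    proof -
      obtain x p where xp: "x \<in> lattice d" "p \<in> perms d" "\<sigma> \<subseteq> ksimp d x p"
        using \<sigma> by (auto simp: K_def)
      have "card (N \<sigma>) \<le> card (N (ksimp d x p))"
        using finite_H xp(3) by (intro card_mono) (auto simp: N_def)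
      also have "\<dots> \<le> d"
        unfolding N_def using few_crossing[OF xp(1,2)] .
      finally show ?thesis .
    qed
    show "cobd (F v) U = 0" if v: "{v} \<in> K" and U: "U \<subseteq> H" "card U = d + 2" for v U
    proof -
      have v_lattice: "v \<in> lattice d"
        using v K_lattice by blast
      have "cobd (F v) U = (\<Sum>u\<in>U. of_bool (encloses (U - {u}) (c v)))"
        unfolding cobd_def
      proof (rule sum.cong)
        fix u assume "u \<in> U"
        then have "U - {u} \<subseteq> H" "card (U - {u}) = d + 1"
          using U by auto
        then show "F v (U - {u}) = of_bool (encloses (U - {u}) (c v))"
          using v_lattice by (simp add: F_def)
      qed simp
      also have "\<dots> = 0"
      proof (rule sum_encloses_facets_eq_0)
        show "f k (c v) \<noteq> 0" if "k \<in> U" for k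
          using off[OF v_lattice] U that by blast
      qed (use U in \<open>simp_all add: d_def\<close>)
      finally show ?thesis .
    qed
    show "F v S = F w S" if vw: "{v, w} \<in> K" and S: "S \<subseteq> H - N {v, w}" "card S = d + 1" for v w S
    proof -
      have lat: "v \<in> lattice d" "w \<in> lattice d"
        using vw K_lattice by blast+
      have "encloses S (c v) \<longleftrightarrow> encloses S (c w)"
      proof (rule encloses_agree)
        fix k assume k: "k \<in> S"
        then have "k \<in> H" "k \<notin> N {v, w}"
          using S by auto
        moreover from this have "f k (c v) \<noteq> 0" "f k (c w) \<noteq> 0"
          using off lat by auto
        ultimately show "f k (c v) \<noteq> 0 \<and> f k (c w) \<noteq> 0 \<and> (0 < f k (c v) \<longleftrightarrow> 0 < f k (c w))"
          by (auto simp: N_def)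
      qed
      then show ?thesis
        using lat by (simp add: F_def)
    qed
    show "F v = (\<lambda>S. 0)" if "v \<notin> B" for v
      using that by (auto simp: F_def B_def d_def)
  qed
  have small: "real (card (supp H (d + 1) (F v))) \<le> A" if "{v} \<in> K" for v
  proof -
    have "supp H (d + 1) (F v) = {S. S \<subseteq> H \<and> card S = CARD('n) + 1 \<and> encloses S (c v)}"
      using K_lattice[OF that] by (auto simp: supp_def F_def d_def)
    then show ?thesis
      using few by simp
  qed
  obtain G where G: "\<And>\<sigma>. \<sigma> \<in> K \<Longrightarrow> \<sigma> \<noteq> {} \<Longrightarrow> card \<sigma> \<le> d + 1 \<Longrightarrow> contracts G \<sigma> (G \<sigma>)"
    using ex_contraction[OF small] A unfolding d_def by blast
  define l where "l v = map_option h (lab d M v)" for v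
  have lab_range: "lab d M v \<in> insert None (Some ` {..d})" for v
    using lab_Some(1)[OF M] by (cases "lab d M v") auto
  have l_range: "l v \<in> insert None (Some ` H')" for v
    using lab_range[of v] h_img by (auto simp: l_def)
  have encloses_iff: "encloses H' (c v) \<longleftrightarrow> l v = None" if "v \<in> lattice d" for v
  proof -
    have "encloses H' (c v) \<longleftrightarrow> (\<forall>i\<le>d. nonneg_side d M v i)"
      unfolding encloses_def using side[OF that] h_img by auto
    then show ?thesis
      by (simp add: l_def lab_None_iff)
  qed
  have l_inside: "v \<in> B" if "v \<in> lattice d" "l v = None" for v
    using that encloses_iff[OF that(1)] H' by (auto simp: B_def d_def)
  define L where "L = label_cochain l H'"
  have fin_H': "finite H'"
    using H' by (simp add: finite_sub)
  have L_vertex: "L {v} H' = F v H'" if "{v} \<in> K" for v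
    using K_lattice[OF that] encloses_iff[of v] H' by (simp add: L_def label_cochain_def F_def)
  have L_closed: "cobd (L \<sigma>) S = cobd (\<lambda>\<tau>. L \<tau> S) \<sigma>"
    if "\<sigma> \<in> K" "card \<sigma> \<le> d + 1" "S \<subseteq> H'" "card S = d + 3 - card \<sigma>" for \<sigma> S
    unfolding L_def
  proof (rule cobd_label_cochain[OF fin_H'])
    show "l ` \<sigma> \<subseteq> insert None (Some ` H')"
      by (intro image_subsetI l_range)
  qed (use that fin_K H' in auto)
  have L_carried: "L \<sigma> S = 0"
    if \<sigma>: "\<sigma> \<in> K" "2 \<le> card \<sigma>" "card \<sigma> \<le> d + 1" and S: "S \<subseteq> H' - N \<sigma>" "card S = d + 2 - card \<sigma>" for \<sigma> S
  proof (rule ccontr)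
    assume "L \<sigma> S \<noteq> 0"
    then have labels: "l ` \<sigma> = insert None (Some ` (H' - S))"
      by (simp add: L_def label_cochain_def)
    then obtain v where v: "v \<in> \<sigma>" "l v = None"
      by (metis imageE insertI1)
    \<comment> \<open>A vertex labelled \<open>i\<close> violates the wall \<open>cyc d i\<close>,
      which the vertex labelled \<open>None\<close> satisfies. So this wall separates the two and
      cannot belong to \<open>S\<close>.\<close>
    have in_N: "h (cyc d i) \<notin> S" if i: "i \<le> d" "h i \<notin> S" for i
    proof -
      have "Some (h i) \<in> l ` \<sigma>"
        using labels i h_img by auto
      then obtain w where "w \<in> \<sigma>" "l w = Some (h i)"
        by (metis imageE)
      then obtain j where w: "w \<in> \<sigma>" "lab d M w = Some j" "h j = h i"
        unfolding l_def map_option_eq_Some by blast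
      have lat: "v \<in> lattice d" "w \<in> lattice d"
        using \<sigma>(1) v(1) w(1) K_lattice by auto
      have "j \<le> d"
        using lab_Some(1)[OF M w(2)] .
      then have "j = i"
        using w(3) i(1) inj_onD[OF h_inj] by auto
      have cyc: "cyc d i \<le> d"
        using i(1) by (simp add: cyc_def)
      then have k: "h (cyc d i) \<in> H"
        using h_img H' by auto
      have "\<not> 0 < bary H' (h (cyc d i)) * f (h (cyc d i)) (c w)"
        using lab_Some(3)[OF M w(2)] side[OF lat(2) cyc] \<open>j = i\<close> by simp
      moreover have "0 < bary H' (h (cyc d i)) * f (h (cyc d i)) (c v)"
        using v(2) side[OF lat(1) cyc] cyc by (simp add: l_def lab_None_iff)
      ultimately have "h (cyc d i) \<in> N \<sigma>"
        using k off[OF lat(1) k] off[OF lat(2) k] v(1) w(1)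
        by (auto simp: N_def zero_less_mult_iff not_less linorder_neq_iff)
      then show ?thesis
        using S(1) by blast
    qed
    have "card S < card H'"
      using S(2) \<sigma>(2) H' by simp
    then obtain i where i: "i \<le> d" "h i \<notin> S"
      using S(1) h_img card_mono[of S H'] fin_H' finite_subset[of S H'] by (metis Diff_subset atMost_iff imageE
          linorder_not_less order_trans subsetI)
    have "h k \<notin> S" if "k \<le> d" for k
      using cyc_closed_imp[of i d "\<lambda>i. h i \<notin> S" k] i in_N that by blast
    then have "S = {}"
      using S(1) h_img by blast
    then show False
      using S(2) \<sigma>(3) by simp
  qed
  have L_outside: "L \<sigma> S = 0" if \<sigma>: "\<sigma> \<in> K" "\<sigma> \<inter> B = {}" for \<sigma> S
  proof -
    have "None \<notin> l ` \<sigma>"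
      using l_inside K_lattice[OF \<sigma>(1)] \<sigma>(2) by (metis disjoint_iff imageE)
    then show ?thesis
      by (auto simp: L_def label_cochain_def)
  qed
  obtain G' where top: "\<And>\<sigma> k. \<sigma> \<in> K \<Longrightarrow> card \<sigma> = d + 1 \<Longrightarrow> k \<in> H' \<Longrightarrow> cobd (\<lambda>\<tau>. G' \<tau> {k}) \<sigma> = L \<sigma> {k}"
    and zero: "\<And>\<sigma>. \<sigma> \<in> K \<Longrightarrow> \<sigma> \<noteq> {} \<Longrightarrow> card \<sigma> \<le> d + 1 \<Longrightarrow> \<sigma> \<inter> B = {} \<Longrightarrow> G' \<sigma> = (\<lambda>T. 0)"
    using extend_contraction[OF G H'(1,2), of L] L_vertex L_closed L_carried L_outside by blast
  show False
  \<comment> \<open>Evaluation at the single hyperplane \<open>h 0\<close> suffices: in top degree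
    its complement in \<open>H'\<close> corresponds to the labels \<open>1..d\<close>.\<close>
  proof (rule no_contraction_of_labels[OF d M fin_B, of "\<lambda>\<tau>. G' \<tau> {h 0}"])
    show "v \<in> B" if "v \<in> lattice d" "lab d M v = None" for v
      using that l_inside by (simp add: l_def)
    show "G' (kfacet d z) {h 0} = 0" if z: "z \<in> kflags d" "kfacet d z \<inter> B = {}" for z
    proof -
      obtain x p k where z_eq: "z = (x, p, k)"
        by (cases z)
      have xp: "x \<in> lattice d" "p \<in> perms d" "k \<le> d"
        using z(1) by (auto simp: z_eq kflags_def)
      have sub: "kfacet d z \<subseteq> ksimp d x p"
        by (auto simp: z_eq kfacet_def ksimp_def)
      then have "kfacet d z \<in> K"
        using xp by (auto simp: K_def)
      moreover have "card (kfacet d z) \<le> d + 1"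
        using card_mono[OF finite_ksimp sub] card_ksimp[OF xp(2)] by simp
      moreover have "\<exists>j\<in>{..d} - {k}. True"
        using d by (intro bexI[of _ "if k = 0 then 1 else 0"]) auto
      then have "kfacet d z \<noteq> {}"
        by (auto simp: z_eq kfacet_def)
      ultimately show ?thesis
        using zero z(2) by simp
    qed
    fix x p assume xp: "x \<in> lattice d" "p \<in> perms d"
    define \<sigma> where "\<sigma> = ksimp d x p"
    have \<sigma>: "\<sigma> \<in> K" "card \<sigma> = d + 1"
      using xp card_ksimp by (auto simp: \<sigma>_def K_def)
    have "h 0 \<in> H'"
      using h_img by auto
    then have "cobd (\<lambda>\<tau>. G' \<tau> {h 0}) \<sigma> = of_bool (l ` \<sigma> = insert None (Some ` (H' - {h 0})))"
      using top[OF \<sigma>] by (simp add: L_def label_cochain_def)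
    also have "l ` \<sigma> = insert None (Some ` (H' - {h 0})) \<longleftrightarrow> lab d M ` \<sigma> = insert None (Some ` {1..d})"
    proof -
      have "H' - {h 0} = h ` ({..d} - {0})"
        using inj_on_image_set_diff[OF h_inj, of "{..d}" "{0}"] h_img by auto
      also have "{..d} - {0} = {1..d}"
        by auto
      finally have "insert None (Some ` (H' - {h 0})) = map_option h ` insert None (Some ` {1..d})"
        by (simp add: image_image)
      moreover have "l ` \<sigma> = map_option h ` lab d M ` \<sigma>"
        by (simp add: l_def image_image)
      moreover have "inj_on (map_option h) (insert None (Some ` {..d}))"
        using h_inj by (auto simp: inj_on_def)
      ultimately show ?thesis
        using lab_range inj_on_image_eq_iff[of "map_option h" "insert None (Some ` {..d})" "lab d M ` \<sigma>"
            "insert None (Some ` {1..d})"] by (simp add: image_subset_iff)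
    qed
    finally show "cobd (\<lambda>\<tau>. G' \<tau> {h 0}) (ksimp d x p) = of_bool (lab d M ` ksimp d x p = insert None (Some ` {1..d}))"
      by (simp add: \<sigma>_def)
  qed
qed

section \<open>From general position to the numerical bound\<close>

lemma arrangement_if_general_position:
  fixes H :: "(real ^ 'n) set set"
  assumes "finite H" "\<forall>h\<in>H. hyperplane h" "general_position H"
  obtains a b where "arrangement H a b"
proof -
  obtain a b where ab: "\<And>h. h \<in> H \<Longrightarrow> a h \<noteq> 0 \<and> h = {x. a h \<bullet> x = b h}"
    using assms(2) unfolding hyperplane_def by metis
  have "arrangement H a b"
  proof
    fix S assume S: "S \<subseteq> H" "card S = CARD('n)"
    have "finite S"
      using S assms(1) finite_subset by blast
    then have "aff_dim (\<Inter>S) = int CARD('n) - int (card S)"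
      using assms(3) S unfolding general_position_def by (simp add: Suc_leI)
    then show "\<Inter>S \<noteq> {}"
      using S aff_dim_empty_eq[where 'a = "real ^ 'n"] by auto
  next
    fix S assume S: "S \<subseteq> H" "card S = CARD('n) + 1"
    then have "finite S"
      using assms(1) finite_subset by blast
    then show "\<Inter>S = {}"
      using assms(3) S unfolding general_position_def by blast
  next
    show "a h \<noteq> 0" "h = {x. a h \<bullet> x = b h}" if "h \<in> H" for h
      using ab[OF that] by auto
  qed (use assms in auto)
  then show thesis
    by (rule that)
qed

text \<open>The error constant comes from
  \<open>(1 - d / n) ^ (d + 1) \<ge> 1 - d * (d + 1) / n\<close>, which is Bernoulli's inequality.
  As the leading factor is positive, the binomial coefficient may be replaced by its upper bound
  \<open>n ^ (d + 1) / fact (d + 1)\<close>.\<close>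

lemma count_bound:
  fixes n d :: nat
  defines "c \<equiv> 2 * real d / (fact (d + 1) * real (d + 1))"
  assumes d: "d \<ge> 1" and n: "d < n" and pos: "0 < c - c * real (d * (d + 1)) / real n"
  shows "(c - c * real (d * (d + 1)) / real n) * real (n choose (d + 1)) * fact d * fact (d + 1) * (real d + 1)\<^sup>2 \<le>
    2 * real d * (real n - real d) ^ (d + 1)"
proof -
  have c: "c * (fact d * (real d + 1)\<^sup>2) = 2 * real d"
  proof -
    have "fact (d + 1) * real (d + 1) = fact d * (real d + 1)\<^sup>2"
      by (simp add: power2_eq_square algebra_simps)
    moreover have "fact d * (real d + 1)\<^sup>2 \<noteq> 0"
      by (simp add: add_eq_0_iff)
    ultimately show ?thesis
      unfolding c_def by (simp only: times_divide_eq_left nonzero_mult_div_cancel_right not_False_eq_True)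
  qed
  have "real (n choose (d + 1)) * fact (d + 1) \<le> real n ^ (d + 1)"
  proof -
    have "(n choose (d + 1)) * fact (d + 1) \<le> n ^ (d + 1)"
    proof -
      have "fact n = (n choose (d + 1)) * fact (d + 1) * fact (n - (d + 1))"
        using n binomial_fact_lemma[of "d + 1" n] by (simp add: mult_ac)
      then have "(n choose (d + 1)) * fact (d + 1) = fact n div fact (n - (d + 1))"
        by simp
      also have "\<dots> \<le> n ^ (d + 1)"
        using n by (intro fact_div_fact_le_pow) simp
      finally show ?thesis .
    qed
    then show ?thesis
      by (metis of_nat_fact of_nat_le_iff of_nat_mult of_nat_power)
  qed
  then have "(c - c * real (d * (d + 1)) / real n) * (real (n choose (d + 1)) * fact (d + 1)) \<le>
      (c - c * real (d * (d + 1)) / real n) * real n ^ (d + 1)"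
    using pos by (intro mult_left_mono) auto
  also have "\<dots> = c * ((1 + real (d + 1) * (- real d / real n)) * real n ^ (d + 1))"
    by (simp add: field_simps)
  also have "\<dots> \<le> c * ((1 + (- real d / real n)) ^ (d + 1) * real n ^ (d + 1))"
  proof (intro mult_left_mono mult_right_mono)
    show "1 + real (d + 1) * (- real d / real n) \<le> (1 + (- real d / real n)) ^ (d + 1)"
      using n by (intro Bernoulli_inequality) (simp add: field_simps)
  qed (simp_all add: c_def)
  also have "\<dots> = c * (real n - real d) ^ (d + 1)"
    using n by (simp add: power_mult_distrib[symmetric] field_simps)
  finally have "(c - c * real (d * (d + 1)) / real n) * (real (n choose (d + 1)) * fact (d + 1)) * (fact d * (real d + 1)\<^sup>2) \<le>
      c * (real n - real d) ^ (d + 1) * (fact d * (real d + 1)\<^sup>2)"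
    by (rule mult_right_mono) simp
  also have "\<dots> = 2 * real d * (real n - real d) ^ (d + 1)"
    using c by (simp add: mult_ac)
  finally show ?thesis
    by (simp add: mult_ac)
qed

theorem theorem3p2:
  "\<exists>K::real. K \<ge> 0 \<and>
     (\<forall>H :: (real ^ 'n) set set.
        finite H \<and> H \<noteq> {} \<and> (\<forall>h\<in>H. hyperplane h) \<and> general_position H \<longrightarrow>
        (\<exists>c :: real ^ 'n.
           real (card {S. S \<subseteq> H \<and> card S = CARD('n) + 1 \<and> surrounds S c}) \<ge>
             (2 * real CARD('n) / (fact (CARD('n) + 1) * real (CARD('n) + 1)) - K / real (card H))
             * real (card H choose (CARD('n) + 1))))"
proof -
  define d where "d = CARD('n)"
  define c0 where "c0 = 2 * real d / (fact (d + 1) * real (d + 1))"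
  define K where "K = c0 * real (d * (d + 1))"
  have d: "d \<ge> 1"
    by (simp add: d_def Suc_leI)
  show ?thesis
    unfolding d_def[symmetric] c0_def[symmetric]
  proof (intro exI[of _ K] conjI allI impI)
    show "K \<ge> 0"
      by (simp add: K_def c0_def)
    fix H :: "(real ^ 'n) set set"
    assume H: "finite H \<and> H \<noteq> {} \<and> (\<forall>h\<in>H. hyperplane h) \<and> general_position H"
    define T where "T = (c0 - K / real (card H)) * real (card H choose (d + 1))"
    show "\<exists>c. T \<le> real (card {S. S \<subseteq> H \<and> card S = d + 1 \<and> surrounds S c})"
    \<comment> \<open>Any point works for \<open>T \<le> 0\<close>. This covers
      \<open>card H \<le> d\<close>, where the binomial coefficient is 0.\<close>
    proof (cases "T \<le> 0")
      case True
      then show ?thesis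
        by (meson of_nat_0_le_iff order_trans)
    next
      case False
      then have n: "d < card H" and pos: "0 < c0 - K / real (card H)"
        by (auto simp: T_def zero_less_mult_iff not_le binomial_eq_0_iff)
      obtain a b where "arrangement H a b"
        using H arrangement_if_general_position by blast
      then interpret arrangement H a b .
      \<comment> \<open>The cardinality being an integer, it suffices to exceed some value just below \<open>T\<close>.\<close>
      define A where "A = real_of_int (\<lceil>T\<rceil> - 1)"
      have A: "A < T"
        unfolding A_def by linarith
      have "A * fact d * fact (d + 1) * (real d + 1)\<^sup>2 < T * fact d * fact (d + 1) * (real d + 1)\<^sup>2"
        using A by (intro mult_strict_right_mono) auto
      also have "\<dots> \<le> 2 * real d * (real (card H) - real d) ^ (d + 1)"
        using count_bound[OF d n] pos unfolding T_def K_def c0_def by blast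
      finally obtain c where c: "A < real (card {S. S \<subseteq> H \<and> card S = d + 1 \<and> encloses S c})"
        using ex_heavily_enclosed[of A, folded d_def, OF n] by blast
      have "T \<le> real (card {S. S \<subseteq> H \<and> card S = d + 1 \<and> encloses S c})"
      proof -
        have "real_of_int (\<lceil>T\<rceil> - 1) < real_of_int (int (card {S. S \<subseteq> H \<and> card S = d + 1 \<and> encloses S c}))"
          using c unfolding A_def of_int_of_nat_eq .
        then have "\<lceil>T\<rceil> - 1 < int (card {S. S \<subseteq> H \<and> card S = d + 1 \<and> encloses S c})"
          unfolding of_int_less_iff .
        then show ?thesis
          by linarith
      qed
      also have "\<dots> \<le> real (card {S. S \<subseteq> H \<and> card S = d + 1 \<and> surrounds S c})"
        using finite_H encloses_imp_surrounds unfolding d_def of_nat_le_iff by (intro card_mono) auto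
      finally show ?thesis
        by blast
    qed
  qed
qed

end
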